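(* Let $S=S(\boldsymbol{\mathcal U}_m,\boldsymbol\Delta,\boldsymbol R)$ be a piecewise Chebyshevian spline space with knots of zero multiplicity which contains constants, and suppose that $DS$ is an ($(m-1)$-dimensional) ECP-space on $(I,\boldsymbol\Delta)$. Let $f_{\ell,m}$, $\ell=1,\dots,m$, be the transition functions of $S$ relative to $[a,b]$, and let $w_1,\dots,w_{m-1}$ be determined recursively, for $j=1,\dots,m-1$, by $$w_j=\sum_{\ell=2}^{m-j+1}Df_{\ell,m-j+1},\qquad f_{\ell,m-j}=\frac{\sum_{h=\ell+1}^{m-j+1}Df_{h,m-j+1}}{w_j},\quad \ell=1,\dots,m-j.$$ Then the sequence $\{\mathbb 1,w_1,\dots,w_{m-1}\}$ is a system of piecewise weight functions associated with $S$. Moreover, the sequence $\{w_1,\dots,w_{m-1}\}$ is a system of piecewise weight functions associated with $DS$.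
   Context: Setting. Let $m\ge 2$, $I=[a,b]$ a closed bounded interval, $\boldsymbol\Delta=\{x_1,\dots,x_k\}$ with $a=x_0<x_1<\dots<x_k<x_{k+1}=b$, and $I_i=[x_i,x_{i+1}]$, $i=0,\dots,k$. A piecewise function on $(I,\boldsymbol\Delta)$ is a function $F$ defined separately on each $I_i$, with restriction $F^{[i]}$ to $I_i$ (so $F(x_i^-)=F^{[i-1]}(x_i)$ and $F(x_i^+)=F^{[i]}(x_i)$ may differ); it is piecewise $C^n$ if each $F^{[i]}\in C^n(I_i)$, and positive if each $F^{[i]}$ is positive on the closed interval $I_i$. $D$ denotes ordinary differentiation, applied separately on each $I_i$. $\mathbb 1$ is the constant function $1$. EC-space. An $n$-dimensional space $\mathcal U\subset C^{n-1}(J)$, $n\geq 1$, on a closed bounded interval $J$ is an Extended Chebyshev space (EC-space) on $J$ if any nonzero element vanishes at most $n-1$ times in $J$, counting multiplicities up to $n$. Spline space with knots of zero multiplicity. $\boldsymbol{\mathcal U}_m=\{\mathcal U_{0,m},\dots,\mathcal U_{k,m}\}$, where each $\mathcal U_{i,m}\subset C^{m-1}(I_i)$ is an $m$-dimensional EC-space on $I_i$. Standing assumption: each $\mathcal U_{i,m}$ contains constants and $D\mathcal U_{i,m}$ is an $(m-1)$-dimensional EC-space on $I_i$. $\boldsymbol R=\{R_1,\dots,R_k\}$, where each $R_i$ is an $m\times m$ lower triangular real matrix with positive diagonal entries and with first row and first column equal to $(1,0,\dots,0)$. $S(\boldsymbol{\mathcal U}_m,\boldsymbol\Delta,\boldsymbol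 R)$ is the ($m$-dimensional) space of all piecewise $C^{m-1}$ functions $s$ on $(I,\boldsymbol\Delta)$ with $s^{[i]}\in\mathcal U_{i,m}$ for $i=0,\dots,k$ and $$\big(D^0s^{[i]}(x_i),\dots,D^{m-1}s^{[i]}(x_i)\big)^T=R_i\,\big(D^0s^{[i-1]}(x_i),\dots,D^{m-1}s^{[i-1]}(x_i)\big)^T,\quad i=1,\dots,k.$$ $DS=\{DF: F\in S\}$. ECP-space. Let $E$ be $S$ (with $n=m$) or $DS$ (with $n=m-1$); its elements are piecewise $C^{n-1}$ and their left and right derivative vectors at $x_i$ are connected by a lower triangular matrix with positive diagonal, so $x_i^+$ is a zero of multiplicity $r\le n$ of $F\in E$ if and only if $x_i^-$ is; such a zero is counted once. Let $Z_n(F)$ be the total number of zeros of $F$ in $I$, counting multiplicities up to $n$. $E$ is an ($n$-dimensional) Extended Chebyshev Piecewise space (ECP-space) on $(I,\boldsymbol\Delta)$ if $Z_n(F)\le n-1$ for every nonzero $F\in E$. Weight functions. A system of $n$ piecewise weight functions is a sequence $\{v_0,\dots,v_{n-1}\}$ of piecewise functions on $(I,\boldsymbol\Delta)$ such that each $v_j$ is positive and piecewise $C^{n-j-1}$. Its generalized derivatives are $L_0F=F/v_0$, $L_jF=\frac1{v_j}DL_{j-1}F$, $j=1,\dots,n-1$, for $F$ piecewise $C^{n-1}$. The system is associated with an $n$-dimensional space $E$ (written $E=ECP(v_0,\dots,v_{n-1})$) if $E$ is the set of all piecewise $C^{n-1}$ functions $F$ on $(I,\boldsymbol\Delta)$ such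 that $L_{n-1}F$ is constant on $I$ and $L_jF^{[i]}(x_i)=L_jF^{[i-1]}(x_i)$ for $i=1,\dots,k$, $j=0,\dots,n-1$. For $S$ one takes $n=m$ and $(v_0,\dots,v_{m-1})=(\mathbb 1,w_1,\dots,w_{m-1})$; for $DS$ one takes $n=m-1$ and $(v_0,\dots,v_{m-2})=(w_1,\dots,w_{m-1})$. Transition functions. The transition functions relative to $[a,b]$ are the functions $f_{\ell,m}\in S$, $\ell=1,\dots,m$, such that $f_{1,m}\equiv1$ and, for $\ell=2,\dots,m$, $$D^rf_{\ell,m}(a)=0,\ r=0,\dots,\ell-2,\qquad D^rf_{\ell,m}(b)=\delta_{r,0},\ r=0,\dots,m-\ell.$$ Recursion. Starting from the transition functions $f_{\ell,m}$, the recursion produces for $j=1,2,\dots,m-1$ first $w_j$ and then the functions $f_{\ell,m-j}$, $\ell=1,\dots,m-j$, used at the next step; that each $w_j$ is positive, so that the division is meaningful, is part of the assertion. *)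

theory Defs
  imports "HOL-Analysis.Analysis" "HOL-Library.Function_Algebras"
begin

text \<open>The pointwise vector space structure makes \<^const>\<open>subspace\<close> and \<^const>\<open>dim\<close> available
  for spaces of functions.\<close>

instantiation "fun" :: (type, real_vector) real_vector
begin

definition scaleR_fun :: "real \<Rightarrow> ('a \<Rightarrow> 'b) \<Rightarrow> 'a \<Rightarrow> 'b"
  where "scaleR_fun c f = (\<lambda>x. c *\<^sub>R f x)"

instance
  by standard (auto simp: scaleR_fun_def fun_eq_iff scaleR_add_right scaleR_add_left)

end


text \<open>A function on a closed interval \<open>J\<close> is represented by the function on the reals that vanishes
  outside \<open>J\<close>, so that equality of functions on \<open>J\<close> is HOL equality. Derivatives at the endpoints
  of \<open>J\<close> are one-sided.\<close>

definition deriv_on :: "real set \<Rightarrow> (real \<Rightarrow> real) \<Rightarrow> real \<Rightarrow> real"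
  where "deriv_on J f = (\<lambda>t. if t \<in> J then vector_derivative f (at t within J) else 0)"

abbreviation derivs_on :: "real set \<Rightarrow> nat \<Rightarrow> (real \<Rightarrow> real) \<Rightarrow> real \<Rightarrow> real"
  where "derivs_on J r f \<equiv> (deriv_on J ^^ r) f"

definition const_on :: "real set \<Rightarrow> real \<Rightarrow> real \<Rightarrow> real"
  where "const_on J c = (\<lambda>t. if t \<in> J then c else 0)"

definition C_on :: "nat \<Rightarrow> real set \<Rightarrow> (real \<Rightarrow> real) set"
  where "C_on n J = {f. (\<forall>t. t \<notin> J \<longrightarrow> f t = 0) \<and>
    (\<forall>r<n. \<forall>t\<in>J. derivs_on J r f differentiable (at t within J)) \<and>
    continuous_on J (derivs_on J n f)}"

definition zero_mult :: "real set \<Rightarrow> nat \<Rightarrow> (real \<Rightarrow> real) \<Rightarrow> real \<Rightarrow> nat"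
  where "zero_mult J n f t = Max {r. r \<le> n \<and> (\<forall>q<r. derivs_on J q f t = 0)}"

definition total_mult :: "real set \<Rightarrow> (real \<Rightarrow> nat) \<Rightarrow> enat"
  where "total_mult T \<mu> =
    (if finite {t \<in> T. \<mu> t \<noteq> 0} then enat (\<Sum>t | t \<in> T \<and> \<mu> t \<noteq> 0. \<mu> t) else \<infinity>)"

text \<open>\<^const>\<open>dim\<close> is \<open>0\<close> on infinite-dimensional spaces, so \<open>n \<ge> 1\<close> and \<open>dim U = n\<close> include
  finite-dimensionality.\<close>

definition EC_space :: "real set \<Rightarrow> nat \<Rightarrow> (real \<Rightarrow> real) set \<Rightarrow> bool"
  where "EC_space J n U \<longleftrightarrow> n \<ge> 1 \<and> U \<subseteq> C_on (n - 1) J \<and> subspace U \<and> dim U = n \<and>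
    (\<forall>f\<in>U. f \<noteq> 0 \<longrightarrow> total_mult J (zero_mult J n f) \<le> enat (n - 1))"


text \<open>The breakpoints are \<open>x 0 < \<dots> < x (Suc k)\<close>. A piecewise function \<open>F\<close> consists of its
  restrictions \<open>F i\<close> to \<open>piece x i\<close> for \<open>i \<le> k\<close>, and \<open>F i = 0\<close> for \<open>i > k\<close>; hence equality of
  piecewise functions is HOL equality.\<close>

type_synonym pw = "nat \<Rightarrow> real \<Rightarrow> real"

definition piece :: "(nat \<Rightarrow> real) \<Rightarrow> nat \<Rightarrow> real set"
  where "piece x i = {x i..x (Suc i)}"

definition pw_C :: "nat \<Rightarrow> nat \<Rightarrow> (nat \<Rightarrow> real) \<Rightarrow> pw set"
  where "pw_C n k x = {F. (\<forall>i\<le>k. F i \<in> C_on n (piece x i)) \<and> (\<forall>i>k. F i = 0)}"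

definition pw_const :: "nat \<Rightarrow> (nat \<Rightarrow> real) \<Rightarrow> real \<Rightarrow> pw"
  where "pw_const k x c = (\<lambda>i. if i \<le> k then const_on (piece x i) c else 0)"

definition pw_deriv :: "nat \<Rightarrow> (nat \<Rightarrow> real) \<Rightarrow> pw \<Rightarrow> pw"
  where "pw_deriv k x F = (\<lambda>i. if i \<le> k then deriv_on (piece x i) (F i) else 0)"

text \<open>Since \<open>0 / 0 = 0\<close> in HOL, the quotient again vanishes off the pieces.\<close>

definition pw_divide :: "pw \<Rightarrow> pw \<Rightarrow> pw"
  where "pw_divide F G = (\<lambda>i t. F i t / G i t)"

definition pw_positive :: "nat \<Rightarrow> (nat \<Rightarrow> real) \<Rightarrow> pw \<Rightarrow> bool"
  where "pw_positive k x F \<longleftrightarrow> (\<forall>i\<le>k. \<forall>t\<in>piece x i. F i t > 0)"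


text \<open>Matrices are indexed from \<open>0\<close>, and only the entries with indices below \<open>m\<close> matter.\<close>

definition connection_matrix :: "nat \<Rightarrow> (nat \<Rightarrow> nat \<Rightarrow> real) \<Rightarrow> bool"
  where "connection_matrix m M \<longleftrightarrow>
    (\<forall>p<m. \<forall>q<m. p < q \<longrightarrow> M p q = 0) \<and>
    (\<forall>p<m. M p p > 0) \<and>
    (\<forall>p<m. M p 0 = (if p = 0 then 1 else 0)) \<and>
    (\<forall>q<m. M 0 q = (if q = 0 then 1 else 0))"

definition spline_space ::
  "nat \<Rightarrow> nat \<Rightarrow> (nat \<Rightarrow> real) \<Rightarrow> (nat \<Rightarrow> (real \<Rightarrow> real) set) \<Rightarrow> (nat \<Rightarrow> nat \<Rightarrow> nat \<Rightarrow> real) \<Rightarrow> pw set"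
  where "spline_space m k x U R = {s \<in> pw_C (m - 1) k x.
    (\<forall>i\<le>k. s i \<in> U i) \<and>
    (\<forall>i\<in>{1..k}. \<forall>p<m. derivs_on (piece x i) p (s i) (x i) =
      (\<Sum>q<m. R i p q * derivs_on (piece x (i - 1)) q (s (i - 1)) (x i)))}"


text \<open>The zeros of a piecewise function are counted at a knot \<open>x i\<close> with the multiplicity of
  \<open>x i\<close> from the right. For splines and their derivatives, the derivative vectors at \<open>x i\<close> from the
  left and from the right are connected by a lower triangular matrix with positive diagonal, so the
  multiplicity from the left is the same.\<close>

definition piece_index :: "nat \<Rightarrow> (nat \<Rightarrow> real) \<Rightarrow> real \<Rightarrow> nat"
  where "piece_index k x t = Max {i. i \<le> k \<and> x i \<le> t}"

definition pw_zero_mult :: "nat \<Rightarrow> (nat \<Rightarrow> real) \<Rightarrow> nat \<Rightarrow> pw \<Rightarrow> real \<Rightarrow> nat"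
  where "pw_zero_mult k x n F t =
    (let i = piece_index k x t in zero_mult (piece x i) n (F i) t)"

definition ECP_space :: "nat \<Rightarrow> (nat \<Rightarrow> real) \<Rightarrow> nat \<Rightarrow> pw set \<Rightarrow> bool"
  where "ECP_space k x n E \<longleftrightarrow> n \<ge> 1 \<and> E \<subseteq> pw_C (n - 1) k x \<and> subspace E \<and> dim E = n \<and>
    (\<forall>F\<in>E. F \<noteq> 0 \<longrightarrow> total_mult {x 0..x (Suc k)} (pw_zero_mult k x n F) \<le> enat (n - 1))"


definition weight_system :: "nat \<Rightarrow> (nat \<Rightarrow> real) \<Rightarrow> nat \<Rightarrow> (nat \<Rightarrow> pw) \<Rightarrow> bool"
  where "weight_system k x n v \<longleftrightarrow>
    (\<forall>j<n. v j \<in> pw_C (n - j - 1) k x \<and> pw_positive k x (v j))"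

primrec gen_deriv :: "nat \<Rightarrow> (nat \<Rightarrow> real) \<Rightarrow> (nat \<Rightarrow> pw) \<Rightarrow> nat \<Rightarrow> pw \<Rightarrow> pw"
  where
    "gen_deriv k x v 0 F = pw_divide F (v 0)"
  | "gen_deriv k x v (Suc j) F = pw_divide (pw_deriv k x (gen_deriv k x v j F)) (v (Suc j))"

definition ECP :: "nat \<Rightarrow> (nat \<Rightarrow> real) \<Rightarrow> nat \<Rightarrow> (nat \<Rightarrow> pw) \<Rightarrow> pw set"
  where "ECP k x n v = {F \<in> pw_C (n - 1) k x.
    (\<exists>c. \<forall>i\<le>k. \<forall>t\<in>piece x i. gen_deriv k x v (n - 1) F i t = c) \<and>
    (\<forall>i\<in>{1..k}. \<forall>j<n. gen_deriv k x v j F i (x i) = gen_deriv k x v j F (i - 1) (x i))}"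

definition associated_weights ::
  "nat \<Rightarrow> (nat \<Rightarrow> real) \<Rightarrow> nat \<Rightarrow> (nat \<Rightarrow> pw) \<Rightarrow> pw set \<Rightarrow> bool"
  where "associated_weights k x n v E \<longleftrightarrow> weight_system k x n v \<and> E = ECP k x n v"


definition transition_functions ::
  "nat \<Rightarrow> nat \<Rightarrow> (nat \<Rightarrow> real) \<Rightarrow> pw set \<Rightarrow> (nat \<Rightarrow> pw) \<Rightarrow> bool"
  where "transition_functions m k x S f \<longleftrightarrow>
    (\<forall>l\<in>{1..m}. f l \<in> S) \<and>
    f 1 = pw_const k x 1 \<and>
    (\<forall>l\<in>{2..m}.
      (\<forall>r\<le>l - 2. derivs_on (piece x 0) r (f l 0) (x 0) = 0) \<and>
      (\<forall>r\<le>m - l. derivs_on (piece x k) r (f l k) (x (Suc k)) = (if r = 0 then 1 else 0)))"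

end

theory Submission
  imports Defs
begin

text \<open>
  Write \<open>n = m - 1\<close> and \<open>B\<^sub>l\<close> for the derivative of the transition
  function with index \<open>l + 2\<close>, \<open>l = 0, \<dots>, n - 1\<close>. The function
  \<open>B\<^sub>l\<close> lies in the \<open>n\<close>-dimensional space \<open>DS\<close> and has
  zeros of order \<open>l\<close> at \<open>a\<close> and \<open>n - 1 - l\<close> at
  \<open>b\<close>. It has one sign in between, and this sign is positive because the transition
  function rises from \<open>0\<close> to \<open>1\<close>. So \<open>w\<^sub>1 = B\<^sub>0 +
  \<dots> + B\<^sub>n\<^sub>-\<^sub>1\<close> is positive on the closed interval; at
  \<open>a\<close> and \<open>b\<close> the first and the last term are responsible. The next
  transition functions are the tails \<open>(B\<^sub>l + \<dots> + B\<^sub>n\<^sub>-\<^sub>1) /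
  w\<^sub>1\<close>, and the derivatives of those with \<open>l \<ge> 1\<close> have the same
  zero pattern at \<open>a\<close> and \<open>b\<close> with \<open>n - 1\<close> in place of \<open>n\<close>. Positivity of all weights
  follows by induction as soon as enough of the bound on the number of zeros is inherited by the
  space of derivatives of quotients by \<open>w\<^sub>1\<close>. For an arbitrary positive element
  of \<open>DS\<close> in place of \<open>w\<^sub>1\<close> this may fail; what is used is that all
  coefficients of \<open>w\<^sub>1\<close> with respect to the \<open>B\<^sub>l\<close> are
  positive.

  The main property carried through the induction (\<open>bernstein_like\<close>) is that a nonzero
  combination of \<open>B\<^sub>l, \<dots>, B\<^sub>n\<^sub>-\<^sub>1\<close> never vanishes
  \<open>n - l\<close> times at one point \<open>t > a\<close>. For the derivatives of the quotients
  this comes down to the following: if \<open>F\<close> is a combination of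
  \<open>B\<^sub>l\<^sub>+\<^sub>1, \<dots>, B\<^sub>n\<^sub>-\<^sub>1\<close> and \<open>F -
  \<gamma> w\<^sub>1\<close> vanishes \<open>n - l\<close> times at \<open>t\<close>, then
  \<open>\<gamma> = 0\<close>. The first \<open>l + 1\<close> coefficients of \<open>F - \<gamma>
  w\<^sub>1\<close> are equal to \<open>- \<gamma>\<close>. So for \<open>t = b\<close> the claim can be
  read off the orders of vanishing, and for \<open>t < b\<close> it is a rule of Descartes
  (\<open>positive_flag_descartes\<close>). The rule is proved by dividing by the last function of the
  family and differentiating, repeatedly, on the half-open interval without \<open>a\<close>: every
  step removes one function and one zero. Positivity of the functions survives, since all the
  quotients vanish at \<open>b\<close> and their derivatives have one sign
  (\<open>flag_one_sign\<close>). At the knots one only needs that leading derivatives are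
  multiplied by a positive factor common to the whole space, and this is inherited by quotients
  (\<open>connected_quotient_family\<close>). The inductive step is \<open>bernstein_step\<close>.

  It remains to see that the weights describe the spaces. If \<open>F\<close> has coefficients
  \<open>c\<close> with respect to the \<open>B\<^sub>l\<close>, its generalized derivative of order
  \<open>j\<close> is the combination of the \<open>j\<close>-th basis whose coefficients are the
  \<open>j\<close>-th differences of \<open>c\<close>, divided by the sum of that basis
  (\<open>gen_deriv_level\<close>). It is therefore continuous at the knots, constant at the last
  order, and its value at \<open>a\<close> is the first of these differences. Such initial values
  can be prescribed, and they determine an element of the space associated with the weights
  (\<open>ECP_eqI\<close>), so \<open>DS\<close> is this space (\<open>range_comb_eq_ECP\<close>).
  The assertion about \<open>S\<close> follows by integration (\<open>weights_of_S\<close>).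
\<close>

section \<open>Iterated one-sided derivatives and orders of vanishing\<close>

definition perfect_set :: "real set \<Rightarrow> bool"
  where "perfect_set J \<longleftrightarrow> (\<forall>t\<in>J. at t within J \<noteq> bot)"

text \<open>Being of class \<open>C\<^sup>n\<close>, by recursion on the order so that the closure
  properties are one-step inductions. Values off \<open>J\<close> are ignored, so that the same
  function can be studied on subsets of \<open>J\<close>; \<open>C_on_iff\<close> is the link with
  \<^const>\<open>C_on\<close>.\<close>

primrec smooth :: "nat \<Rightarrow> real set \<Rightarrow> (real \<Rightarrow> real) \<Rightarrow> bool"
  where
    "smooth 0 J f \<longleftrightarrow> continuous_on J f"
  | "smooth (Suc n) J f \<longleftrightarrow>
      (\<forall>t\<in>J. f differentiable at t within J) \<and> smooth n J (deriv_on J f)"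

lemma perfect_Icc: "a < b \<Longrightarrow> perfect_set {a..b::real}"
  unfolding perfect_set_def by (metis islimpt_Icc trivial_limit_within)

lemma perfect_Ioc: "a < b \<Longrightarrow> perfect_set {a<..b::real}"
  unfolding perfect_set_def
proof
  fix t assume "a < b" "t \<in> {a<..b}"
  then have "t islimpt {a<..<t}"
    using islimpt_greaterThanLessThan2[of a t] by auto
  then have "t islimpt {a<..b}"
    using \<open>t \<in> {a<..b}\<close> by (elim islimpt_subset) auto
  then show "at t within {a<..b} \<noteq> bot"
    by (simp add: trivial_limit_within)
qed

lemma deriv_on_eqI:
  assumes "perfect_set J" "t \<in> J" "(f has_real_derivative d) (at t within J)"
  shows "deriv_on J f t = d"
  using assms vector_derivative_within[of t J f d]
  by (auto simp: deriv_on_def perfect_set_def has_real_derivative_iff_has_vector_derivative)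

lemma deriv_on_works:
  assumes "t \<in> J" "f differentiable at t within J"
  shows "(f has_real_derivative deriv_on J f t) (at t within J)"
  using assms vector_derivative_works[of f "at t within J"]
  by (auto simp: deriv_on_def has_real_derivative_iff_has_vector_derivative)

lemma differentiable_real: "(f has_real_derivative d) F \<Longrightarrow> f differentiable F"
  using has_field_derivative_def differentiable_def by blast

lemma deriv_on_outside: "t \<notin> J \<Longrightarrow> deriv_on J f t = 0"
  by (simp add: deriv_on_def)

lemma deriv_on_cong:
  assumes "\<And>t. t \<in> J \<Longrightarrow> f t = g t"
  shows "deriv_on J f = deriv_on J g"
proof
  fix t
  have "vector_derivative f (at t within J) = vector_derivative g (at t within J)" if "t \<in> J"
    using that assms by (intro vector_derivative_cong_eq always_eventually) blast+
  then show "deriv_on J f t = deriv_on J g t"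
    by (auto simp: deriv_on_def)
qed

lemma derivs_on_Suc: "derivs_on J (Suc r) f = derivs_on J r (deriv_on J f)"
  by (simp only: funpow_Suc_right o_apply)

lemma derivs_on_cong:
  assumes "\<And>t. t \<in> J \<Longrightarrow> f t = g t" "t \<in> J"
  shows "derivs_on J r f t = derivs_on J r g t"
proof (cases r)
  case (Suc q)
  have "deriv_on J f = deriv_on J g" using assms(1) by (rule deriv_on_cong)
  then show ?thesis unfolding Suc derivs_on_Suc by (rule arg_cong)
qed (use assms in auto)

lemma differentiable_cong_on:
  assumes "\<And>t. t \<in> J \<Longrightarrow> f t = (g t :: real)" "t \<in> J" "f differentiable at t within J"
  shows "g differentiable at t within J"
  using assms differentiable_transform_within[of f t J 1 g] by auto

lemma smooth_cong:
  assumes "\<And>t. t \<in> J \<Longrightarrow> f t = g t" "smooth n J f"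
  shows "smooth n J g"
proof (cases n)
  case 0
  then show ?thesis using assms continuous_on_cong[of J J f g] by simp
next
  case (Suc k)
  then show ?thesis
    using assms deriv_on_cong[OF assms(1), of J] differentiable_cong_on[OF assms(1), of J] by auto
qed

lemma smooth_Suc_imp: "smooth (Suc n) J f \<Longrightarrow> smooth n J f"
proof (induction n arbitrary: f)
  case 0
  then show ?case
    by (auto simp: continuous_on_eq_continuous_within intro: differentiable_imp_continuous_within)
qed auto

lemma smooth_mono: "smooth n J f \<Longrightarrow> r \<le> n \<Longrightarrow> smooth r J f"
  by (induction n) (auto simp: le_Suc_eq dest: smooth_Suc_imp simp del: smooth.simps)

lemma smooth_continuous: "smooth n J f \<Longrightarrow> continuous_on J f"
  using smooth_mono[of n J f 0] by simp

lemma smooth_iff: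
  "smooth n J f \<longleftrightarrow> (\<forall>r<n. \<forall>t\<in>J. derivs_on J r f differentiable (at t within J)) \<and>
    continuous_on J (derivs_on J n f)"
proof (induction n arbitrary: f)
  case (Suc n)
  show ?case
    unfolding smooth.simps(2) Suc derivs_on_Suc All_less_Suc2 by auto
qed auto

lemma C_on_iff: "f \<in> C_on n J \<longleftrightarrow> (\<forall>t. t \<notin> J \<longrightarrow> f t = 0) \<and> smooth n J f"
  by (auto simp: C_on_def smooth_iff)

context
  fixes J :: "real set"
  assumes J: "perfect_set J"
begin

lemma deriv_on_const: "deriv_on J (\<lambda>t. c) = (\<lambda>t. 0)"
proof
  show "deriv_on J (\<lambda>t. c) t = 0" for t
    using deriv_on_eqI[OF J, of t "\<lambda>t. c" 0] by (cases "t \<in> J") (auto simp: deriv_on_outside)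
qed

lemma smooth_const: "smooth n J (\<lambda>t. c)"
  by (induction n arbitrary: c) (auto simp: deriv_on_const)

lemma deriv_on_add:
  assumes "\<forall>t\<in>J. f differentiable at t within J" "\<forall>t\<in>J. g differentiable at t within J"
  shows "deriv_on J (\<lambda>t. f t + g t) = (\<lambda>t. deriv_on J f t + deriv_on J g t)"
proof
  show "deriv_on J (\<lambda>t. f t + g t) t = deriv_on J f t + deriv_on J g t" for t
    using assms deriv_on_eqI[OF J] deriv_on_works[of t J]
    by (cases "t \<in> J") (auto simp: deriv_on_outside intro!: deriv_on_eqI[OF J] DERIV_add)
qed

lemma deriv_on_cmult:
  assumes "\<forall>t\<in>J. f differentiable at t within J"
  shows "deriv_on J (\<lambda>t. c * f t) = (\<lambda>t. c * deriv_on J f t)"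
proof
  show "deriv_on J (\<lambda>t. c * f t) t = c * deriv_on J f t" for t
    using assms deriv_on_works[of t J]
    by (cases "t \<in> J") (auto simp: deriv_on_outside intro!: deriv_on_eqI[OF J] DERIV_cmult)
qed

lemma deriv_on_mult:
  assumes "\<forall>t\<in>J. f differentiable at t within J" "\<forall>t\<in>J. g differentiable at t within J"
  shows "deriv_on J (\<lambda>t. f t * g t) = (\<lambda>t. deriv_on J f t * g t + f t * deriv_on J g t)"
proof
  show "deriv_on J (\<lambda>t. f t * g t) t = deriv_on J f t * g t + f t * deriv_on J g t" for t
  proof (cases "t \<in> J")
    case True
    then show ?thesis
      using DERIV_mult[OF deriv_on_works[of t J f] deriv_on_works[of t J g]] assms
      by (auto intro!: deriv_on_eqI[OF J] simp: algebra_simps)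
  qed (auto simp: deriv_on_outside)
qed

lemma smooth_add: "smooth n J f \<Longrightarrow> smooth n J g \<Longrightarrow> smooth n J (\<lambda>t. f t + g t)"
  by (induction n arbitrary: f g) (auto simp: deriv_on_add intro: continuous_on_add)

lemma smooth_cmult: "smooth n J f \<Longrightarrow> smooth n J (\<lambda>t. c * f t)"
  by (induction n arbitrary: f) (auto simp: deriv_on_cmult intro!: continuous_intros)

lemma smooth_mult: "smooth n J f \<Longrightarrow> smooth n J g \<Longrightarrow> smooth n J (\<lambda>t. f t * g t)"
proof (induction n arbitrary: f g)
  case (Suc n)
  then have "smooth n J f" "smooth n J g" "smooth n J (deriv_on J f)" "smooth n J (deriv_on J g)"
    using smooth_Suc_imp by (auto simp del: smooth.simps) auto
  then show ?case
    using Suc by (auto simp: deriv_on_mult intro!: smooth_add)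
qed (auto intro: continuous_on_mult)

lemma smooth_divide:
  "smooth n J f \<Longrightarrow> smooth n J u \<Longrightarrow> \<forall>t\<in>J. u t \<noteq> 0 \<Longrightarrow> smooth n J (\<lambda>t. f t / u t)"
proof (induction n arbitrary: f u)
  case 0
  then show ?case by (auto intro: continuous_on_divide)
next
  case (Suc n)
  have "deriv_on J (\<lambda>t. f t / u t) t =
      (deriv_on J f t * u t + (- 1) * (f t * deriv_on J u t)) / (u t * u t)" if "t \<in> J" for t
    using that Suc.prems DERIV_divide[OF deriv_on_works[of t J f] deriv_on_works[of t J u]]
    by (auto intro!: deriv_on_eqI[OF J])
  moreover have "smooth n J
      (\<lambda>t. (deriv_on J f t * u t + (- 1) * (f t * deriv_on J u t)) / (u t * u t))"
  proof (rule Suc.IH)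
    show "smooth n J (\<lambda>t. u t * u t)"
      using Suc.prems smooth_Suc_imp smooth_mult by blast
    show "smooth n J (\<lambda>t. deriv_on J f t * u t + (- 1) * (f t * deriv_on J u t))"
      using Suc.prems smooth_Suc_imp[of n J f] smooth_Suc_imp[of n J u]
      by (intro smooth_add smooth_cmult smooth_mult) auto
  qed (use Suc.prems in auto)
  ultimately have "smooth n J (deriv_on J (\<lambda>t. f t / u t))"
    using smooth_cong[of J "\<lambda>t. (deriv_on J f t * u t + (- 1) * (f t * deriv_on J u t)) / (u t * u t)"
        "deriv_on J (\<lambda>t. f t / u t)" n] by presburger
  then show ?case
    using Suc.prems by auto
qed

lemma smooth_sum:
  fixes N :: nat
  shows "(\<And>l. l < N \<Longrightarrow> smooth n J (f l)) \<Longrightarrow> smooth n J (\<lambda>t. \<Sum>l<N. f l t)"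
  by (induction N) (auto intro: smooth_add smooth_const)

lemma deriv_on_sum:
  fixes N :: nat
  assumes "\<And>l. l < N \<Longrightarrow> smooth (Suc n) J (f l)"
  shows "deriv_on J (\<lambda>t. \<Sum>l<N. f l t) = (\<lambda>t. \<Sum>l<N. deriv_on J (f l) t)"
  using assms
proof (induction N)
  case (Suc N)
  then have "smooth (Suc n) J (\<lambda>t. \<Sum>l<N. f l t)" by (intro smooth_sum) auto
  then show ?case using Suc by (simp add: deriv_on_add)
qed (auto simp: deriv_on_const)

lemma derivs_on_add:
  assumes "smooth n J f" "smooth n J g" "r \<le> n"
  shows "derivs_on J r (\<lambda>t. f t + g t) = (\<lambda>t. derivs_on J r f t + derivs_on J r g t)"
  using assms
proof (induction r arbitrary: f g n)
  case (Suc r)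
  then obtain k where "n = Suc k" by (cases n) auto
  then show ?case using Suc.prems Suc.IH[of k "deriv_on J f" "deriv_on J g"]
    by (simp add: derivs_on_Suc deriv_on_add del: funpow.simps)
qed auto

lemma derivs_on_cmult:
  assumes "smooth n J f" "r \<le> n"
  shows "derivs_on J r (\<lambda>t. c * f t) = (\<lambda>t. c * derivs_on J r f t)"
  using assms
proof (induction r arbitrary: f n)
  case (Suc r)
  then obtain k where "n = Suc k" by (cases n) auto
  then show ?case using Suc.prems Suc.IH[of k "deriv_on J f"]
    by (simp add: derivs_on_Suc deriv_on_cmult del: funpow.simps)
qed auto

lemma derivs_on_zero: "derivs_on J r (\<lambda>t. 0) = (\<lambda>t. 0)"
  by (induction r) (auto simp: deriv_on_const)

lemma derivs_on_sum:
  fixes N :: nat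
  assumes "\<And>l. l < N \<Longrightarrow> smooth n J (f l)" "r \<le> n"
  shows "derivs_on J r (\<lambda>t. \<Sum>l<N. f l t) = (\<lambda>t. \<Sum>l<N. derivs_on J r (f l) t)"
  using assms(1)
proof (induction N)
  case (Suc N)
  then have "smooth n J (\<lambda>t. \<Sum>l<N. f l t)" by (intro smooth_sum) auto
  then show ?case using Suc assms(2) by (simp add: derivs_on_add)
qed (auto simp: derivs_on_zero)

end

definition vanishes :: "real set \<Rightarrow> nat \<Rightarrow> (real \<Rightarrow> real) \<Rightarrow> real \<Rightarrow> bool"
  where "vanishes J r f t \<longleftrightarrow> (\<forall>q<r. derivs_on J q f t = 0)"

lemma vanishes_0 [simp]: "vanishes J 0 f t"
  by (simp add: vanishes_def)

lemma vanishes_1 [simp]: "vanishes J (Suc 0) f t \<longleftrightarrow> f t = 0"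
  by (simp add: vanishes_def)

lemma vanishes_mono: "vanishes J r f t \<Longrightarrow> q \<le> r \<Longrightarrow> vanishes J q f t"
  by (auto simp: vanishes_def)

lemma vanishes_Suc: "vanishes J (Suc r) f t \<longleftrightarrow> vanishes J r f t \<and> derivs_on J r f t = 0"
  by (auto simp: vanishes_def less_Suc_eq)

lemma vanishes_Suc_deriv: "vanishes J (Suc r) f t \<longleftrightarrow> f t = 0 \<and> vanishes J r (deriv_on J f) t"
  by (auto simp: vanishes_def All_less_Suc2 derivs_on_Suc simp del: funpow.simps)

lemma vanishes_cong:
  assumes "\<And>t. t \<in> J \<Longrightarrow> f t = g t" "t \<in> J"
  shows "vanishes J r f t \<longleftrightarrow> vanishes J r g t"
  using derivs_on_cong[of J f g t] assms by (simp add: vanishes_def)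

text \<open>At a zero of order \<open>r\<close> of \<open>g\<close> only one term of the Leibniz
  formula for the \<open>r\<close>-th derivative survives, hence a factor \<open>u\<close> cannot
  lower the order and rescales the leading derivative by \<open>u t\<close>.\<close>

lemma derivs_on_mult_vanishing:
  assumes J: "perfect_set J" and "t \<in> J" "smooth r J g" "smooth r J u" "vanishes J r g t"
  shows "derivs_on J r (\<lambda>t. g t * u t) t = derivs_on J r g t * u t"
  using assms(3-5)
proof (induct r arbitrary: g u)
  case (Suc r)
  let ?g' = "deriv_on J g" and ?u' = "deriv_on J u"
  have s: "smooth r J g" "smooth r J u" "smooth r J ?g'" "smooth r J ?u'"
    using smooth_Suc_imp[OF Suc.prems(1)] smooth_Suc_imp[OF Suc.prems(2)] Suc.prems(1,2) by simp_all
  have v': "vanishes J r ?g' t"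
    using Suc.prems(3) unfolding vanishes_Suc_deriv by (simp_all)
  have v: "vanishes J r g t" "derivs_on J r g t = 0"
    using Suc.prems(3) unfolding vanishes_Suc by simp_all
  have "derivs_on J (Suc r) (\<lambda>t. g t * u t) t = derivs_on J r (\<lambda>t. ?g' t * u t + g t * ?u' t) t"
    using Suc.prems by (subst derivs_on_Suc, subst deriv_on_mult[OF J]) auto
  also have "\<dots> = derivs_on J r (\<lambda>t. ?g' t * u t) t + derivs_on J r (\<lambda>t. g t * ?u' t) t"
    using derivs_on_add[OF J smooth_mult[OF J s(3,2)] smooth_mult[OF J s(1,4)], of r] by simp
  also have "\<dots> = derivs_on J (Suc r) g t * u t"
    using Suc.hyps[OF s(3,2) v'] Suc.hyps[OF s(1,4) v(1)] v(2)
    unfolding derivs_on_Suc by simp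
  finally show ?case .
qed (simp)

lemma vanishes_mult:
  assumes "perfect_set J" "t \<in> J" "smooth n J g" "smooth n J u" "r \<le> Suc n" "vanishes J r g t"
  shows "vanishes J r (\<lambda>t. g t * u t) t"
  unfolding vanishes_def
proof safe
  fix q assume "q < r"
  then show "derivs_on J q (\<lambda>t. g t * u t) t = 0"
    using derivs_on_mult_vanishing[of J t q g u] assms smooth_mono[of n J _ q]
    by (auto simp: vanishes_def)
qed

lemma vanishes_divide_iff:
  assumes "perfect_set J" "t \<in> J" "smooth n J f" "smooth n J u" "\<forall>t\<in>J. u t \<noteq> 0" "r \<le> Suc n"
  shows "vanishes J r (\<lambda>t. f t / u t) t \<longleftrightarrow> vanishes J r f t"
proof
  assume "vanishes J r (\<lambda>t. f t / u t) t"
  then have "vanishes J r (\<lambda>t. f t / u t * u t) t"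
    using vanishes_mult[of J t n "\<lambda>t. f t / u t" u r] assms by (auto intro: smooth_divide)
  then show "vanishes J r f t"
    by (subst (asm) vanishes_cong[where g = f]) (use assms in auto)
next
  assume "vanishes J r f t"
  then have "vanishes J r (\<lambda>t. f t * (1 / u t)) t"
    using vanishes_mult[of J t n f "\<lambda>t. 1 / u t" r] smooth_divide[of J n "\<lambda>t. 1" u] assms
    by (auto simp: smooth_const)
  then show "vanishes J r (\<lambda>t. f t / u t) t" by simp
qed

lemma derivs_on_divide_vanishing:
  assumes "perfect_set J" "t \<in> J" "smooth r J f" "smooth r J u" "\<forall>t\<in>J. u t \<noteq> 0"
    "vanishes J r f t"
  shows "derivs_on J r (\<lambda>t. f t / u t) t = derivs_on J r f t / u t"
  using derivs_on_mult_vanishing[of J t r f "\<lambda>t. 1 / u t"] smooth_divide[of J r "\<lambda>t. 1" u] assms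
  by (auto simp: smooth_const)

text \<open>The derivative of \<open>f / u\<close> does not see a multiple of \<open>u\<close> added
  to \<open>f\<close>. Choosing the multiple that makes \<open>f\<close> vanish at \<open>t\<close>
  turns the zeros at \<open>t\<close> of the derivative of \<open>f / u\<close> into zeros of an
  element of the space spanned by \<open>f\<close> and \<open>u\<close>, of order one
  higher.\<close>

lemma deriv_on_divide_shift:
  assumes "perfect_set J" "\<forall>t\<in>J. u t \<noteq> 0" "smooth (Suc n) J f" "smooth (Suc n) J u"
  shows "deriv_on J (\<lambda>s. f s / u s) = deriv_on J (\<lambda>s. (f s - c * u s) / u s)"
proof -
  have "deriv_on J (\<lambda>s. (f s - c * u s) / u s) = deriv_on J (\<lambda>s. f s / u s + (- c))"
    using assms by (intro deriv_on_cong) (auto simp: field_simps)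
  also have "\<dots> = deriv_on J (\<lambda>s. f s / u s)"
  proof -
    have "smooth (Suc n) J (\<lambda>s. f s / u s)" using assms by (intro smooth_divide)
    then show ?thesis
      using assms by (subst deriv_on_add) (auto simp: deriv_on_const)
  qed
  finally show ?thesis ..
qed

lemma smooth_diff_cmult:
  assumes "perfect_set J" "smooth n J f" "smooth n J u"
  shows "smooth n J (\<lambda>s. f s - c * u s)"
  using smooth_add[OF assms(1,2) smooth_cmult[OF assms(1,3), of "- c"]] by simp

lemma vanishes_deriv_quotient:
  assumes "perfect_set J" "t \<in> J" "smooth n J f" "smooth n J u" "\<forall>t\<in>J. u t \<noteq> 0" "r \<le> n" "n \<ge> 1"
  shows "vanishes J r (deriv_on J (\<lambda>s. f s / u s)) t \<longleftrightarrow>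
    vanishes J (Suc r) (\<lambda>s. f s - f t / u t * u s) t"
proof -
  obtain p where p: "n = Suc p" using assms(7) by (cases n) auto
  let ?g = "\<lambda>s. f s - f t / u t * u s"
  have z: "?g t = 0" using assms by simp
  have "vanishes J r (deriv_on J (\<lambda>s. f s / u s)) t \<longleftrightarrow> vanishes J (Suc r) (\<lambda>s. ?g s / u s) t"
    unfolding vanishes_Suc_deriv z
      deriv_on_divide_shift[OF assms(1,5) assms(3,4)[unfolded p], of "f t / u t"] by simp
  also have "\<dots> \<longleftrightarrow> vanishes J (Suc r) ?g t"
  proof (rule vanishes_divide_iff)
    show "smooth n J ?g" using assms(1,3,4) by (rule smooth_diff_cmult)
  qed (use assms in auto)
  finally show ?thesis .
qed

lemma derivs_deriv_quotient:
  assumes "perfect_set J" "t \<in> J" "smooth n J f" "smooth n J u" "\<forall>t\<in>J. u t \<noteq> 0" "Suc r \<le> n"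
    "vanishes J (Suc r) (\<lambda>s. f s - f t / u t * u s) t"
  shows "derivs_on J r (deriv_on J (\<lambda>s. f s / u s)) t =
    derivs_on J (Suc r) (\<lambda>s. f s - f t / u t * u s) t / u t"
proof -
  obtain p where p: "n = Suc p" using assms(6) by (cases n) auto
  let ?g = "\<lambda>s. f s - f t / u t * u s"
  have "derivs_on J r (deriv_on J (\<lambda>s. f s / u s)) t = derivs_on J (Suc r) (\<lambda>s. ?g s / u s) t"
    unfolding derivs_on_Suc
    by (rule arg_cong[OF deriv_on_divide_shift[OF assms(1,5) assms(3,4)[unfolded p]]])
  also have "\<dots> = derivs_on J (Suc r) ?g t / u t"
  proof (rule derivs_on_divide_vanishing)
    show "smooth (Suc r) J ?g" "smooth (Suc r) J u"
      using smooth_mono[OF smooth_diff_cmult[OF assms(1,3,4)] assms(6)] smooth_mono[OF assms(4,6)] .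
  qed (use assms in blast)+
  finally show ?thesis .
qed

lemma derivs_on_subset:
  assumes "perfect_set J" "perfect_set K" "K \<subseteq> J" "smooth n J f"
  shows "smooth n K f" "t \<in> K \<Longrightarrow> r \<le> n \<Longrightarrow> derivs_on K r f t = derivs_on J r f t"
proof -
  have "smooth n K f \<and> (\<forall>t\<in>K. \<forall>r\<le>n. derivs_on K r f t = derivs_on J r f t)"
    using assms(4)
  proof (induction n arbitrary: f)
    case 0
    then show ?case using continuous_on_subset assms by auto
  next
    case (Suc n)
    have d: "(f has_real_derivative deriv_on J f t) (at t within K)" if "t \<in> K" for t
      using that Suc.prems assms(3) DERIV_subset[OF deriv_on_works[of t J f]] by auto
    have e: "deriv_on K f t = deriv_on J f t" if "t \<in> K" for t
      using that d assms deriv_on_eqI by blast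
    have e1: "smooth n K (deriv_on J f) \<and> (\<forall>t\<in>K. \<forall>r\<le>n. derivs_on K r (deriv_on J f) t =
        derivs_on J r (deriv_on J f) t)"
      using Suc by simp
    have e2: "derivs_on K r (deriv_on K f) t = derivs_on K r (deriv_on J f) t"
      if "t \<in> K" for r t
      using that e by (intro derivs_on_cong) auto
    have "f differentiable at t within K" if "t \<in> K" for t
      using differentiable_real[OF d[OF that]] .
    then have "smooth (Suc n) K f"
      using smooth_cong[of K "deriv_on J f" "deriv_on K f" n] e e1 by simp
    moreover have "derivs_on K r f t = derivs_on J r f t" if "t \<in> K" "r \<le> Suc n" for t r
    proof (cases r)
      case (Suc q)
      then have "q \<le> n" using that by simp
      then have "derivs_on K q (deriv_on K f) t = derivs_on J q (deriv_on J f) t"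
        using e1 e2 \<open>t \<in> K\<close> by metis
      then show ?thesis
        unfolding Suc derivs_on_Suc .
    qed simp
    ultimately show ?case by blast
  qed
  then show "smooth n K f" "t \<in> K \<Longrightarrow> r \<le> n \<Longrightarrow> derivs_on K r f t = derivs_on J r f t" by auto
qed

lemma mvt_on:
  assumes "is_interval J" "perfect_set J" "smooth (Suc n) J f" "s \<in> J" "t \<in> J" "s < t"
  obtains z where "s < z" "z < t" "z \<in> J" "f t - f s = deriv_on J f z * (t - s)"
proof -
  have sub: "{s..t} \<subseteq> J"
  proof
    fix y assume "y \<in> {s..t}"
    then show "y \<in> J"
      using mem_is_interval_1_I[OF assms(1,4,5), of y] by simp
  qed
  have "\<exists>x\<in>{s<..<t}. f t - f s = (\<lambda>h. deriv_on J f x * h) (t - s)"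
  proof (rule mvt_simple[OF assms(6)])
    fix x assume "s \<le> x" "x \<le> t"
    then have "x \<in> J" using sub by auto
    then have "(f has_real_derivative deriv_on J f x) (at x within {s..t})"
      using DERIV_subset[OF deriv_on_works[of x J f] sub] assms(3) by auto
    then show "(f has_derivative (*) (deriv_on J f x)) (at x within {s..t})"
      by (simp add: has_field_derivative_def)
  qed
  then obtain z where "z \<in> {s<..<t}" "f t - f s = deriv_on J f z * (t - s)" by blast
  moreover have "z \<in> J" using sub \<open>z \<in> {s<..<t}\<close> by auto
  ultimately show ?thesis using that[of z] by auto
qed

section \<open>Families of piecewise functions connected at the knots\<close>

definition comb :: "nat \<Rightarrow> (nat \<Rightarrow> real) \<Rightarrow> (nat \<Rightarrow> pw) \<Rightarrow> pw"
  where "comb n c B = (\<lambda>i t. \<Sum>l<n. c l * B l i t)"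

lemma comb_cong: "(\<And>l. l < n \<Longrightarrow> c l = d l) \<Longrightarrow> comb n c B = comb n d B"
  by (auto simp: comb_def fun_eq_iff intro!: sum.cong)

lemma comb_Suc: "comb (Suc n) c B i t = comb n c B i t + c n * B n i t"
  by (simp add: comb_def)

lemma comb_unit:
  assumes "l < n"
  shows "comb n (\<lambda>q. if q = l then 1 else 0) B = B l"
proof (intro ext)
  fix i t
  have "(\<Sum>q<n. (if q = l then 1 else 0) * B q i t) = (\<Sum>q<n. if q = l then B q i t else 0)"
    by (intro sum.cong) auto
  then show "comb n (\<lambda>q. if q = l then 1 else 0) B i t = B l i t"
    using assms by (simp add: comb_def)
qed

lemma comb_diff: "comb n c B i t - a * comb n d B i t = comb n (\<lambda>q. c q - a * d q) B i t"
  by (simp add: comb_def sum_distrib_left sum_subtractf[symmetric] algebra_simps)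

lemma comb_cmult: "comb n (\<lambda>q. a * c q) B i t = a * comb n c B i t"
  by (simp add: comb_def sum_distrib_left algebra_simps)

text \<open>The first piece may lack its left end point. On such a partition one can divide by a
  function that vanishes at the left end of the whole interval and nowhere else.\<close>

locale partition =
  fixes k :: nat and x :: "nat \<Rightarrow> real" and J :: "nat \<Rightarrow> real set"
  assumes less: "i \<le> k \<Longrightarrow> x i < x (Suc i)"
    and J_0: "J 0 = piece x 0 \<or> J 0 = {x 0<..x (Suc 0)}"
    and J_Suc: "J (Suc i) = piece x (Suc i)"
begin

lemma J_cases: "J i = {x i..x (Suc i)} \<or> J i = {x i<..x (Suc i)}"
  using J_0 J_Suc by (cases i) (auto simp: piece_def)

lemma perfect_J: "i \<le> k \<Longrightarrow> perfect_set (J i)"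
  using J_cases[of i] less[of i] perfect_Icc perfect_Ioc by metis

lemma interval_J: "is_interval (J i)"
  using J_cases[of i] by (auto simp: is_interval_cc is_interval_oc)

lemma right_J:
  assumes "i \<le> k"
  shows "x (Suc i) \<in> J i"
  using J_cases[of i] less[OF assms] by (elim disjE) simp_all

lemma left_J:
  assumes "i < k"
  shows "x (Suc i) \<in> J (Suc i)"
  using less[OF Suc_leI[OF assms]] unfolding J_Suc piece_def by simp

lemma le_right_J: "t \<in> J i \<Longrightarrow> t \<le> x (Suc i)"
  using J_cases[of i] by (elim disjE) simp_all

definition smooth_family :: "nat \<Rightarrow> (nat \<Rightarrow> pw) \<Rightarrow> bool"
  where "smooth_family n B \<longleftrightarrow> (\<forall>l<n. \<forall>i\<le>k. smooth (n - 1) (J i) (B l i))"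

text \<open>What remains of the connection matrices for a space of functions: the first derivative
  that does not vanish at a knot is multiplied by a positive factor which is the same for the whole
  space. This form is inherited by quotients and their derivatives, and it implies that orders of
  vanishing from the left pass to the right.\<close>

definition connected_family :: "nat \<Rightarrow> (nat \<Rightarrow> pw) \<Rightarrow> bool"
  where "connected_family n B \<longleftrightarrow> (\<forall>i<k. \<forall>r<n. \<exists>\<rho>>0. \<forall>c.
    vanishes (J i) r (comb n c B i) (x (Suc i)) \<longrightarrow>
    derivs_on (J (Suc i)) r (comb n c B (Suc i)) (x (Suc i)) =
      \<rho> * derivs_on (J i) r (comb n c B i) (x (Suc i)))"

lemma smooth_comb:
  assumes "smooth_family (Suc n) B" "i \<le> k"
  shows "smooth n (J i) (comb (Suc n) c B i)"
proof -
  have "smooth n (J i) (\<lambda>t. \<Sum>l<Suc n. c l * B l i t)"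
    using assms by (intro smooth_sum smooth_cmult perfect_J) (auto simp: smooth_family_def)
  then show ?thesis by (simp add: comb_def)
qed

lemma connected_vanishes:
  assumes "connected_family n B" "i < k" "r \<le> n"
    "vanishes (J i) r (comb n c B i) (x (Suc i))"
  shows "vanishes (J (Suc i)) r (comb n c B (Suc i)) (x (Suc i))"
  unfolding vanishes_def
proof safe
  fix q assume "q < r"
  then have "vanishes (J i) q (comb n c B i) (x (Suc i))" "q < n"
    "derivs_on (J i) q (comb n c B i) (x (Suc i)) = 0"
    using assms(3,4) by (auto simp: vanishes_def)
  then show "derivs_on (J (Suc i)) q (comb n c B (Suc i)) (x (Suc i)) = 0"
    using assms(1,2) unfolding connected_family_def by (metis mult_zero_right)
qed

lemma connected_values:
  assumes "connected_family n B" "i < k" "n > 0"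
  obtains \<rho> where "\<rho> > 0" "\<And>c. comb n c B (Suc i) (x (Suc i)) = \<rho> * comb n c B i (x (Suc i))"
proof -
  obtain \<rho> where "\<rho> > 0" "\<forall>c. vanishes (J i) 0 (comb n c B i) (x (Suc i)) \<longrightarrow>
      derivs_on (J (Suc i)) 0 (comb n c B (Suc i)) (x (Suc i)) =
      \<rho> * derivs_on (J i) 0 (comb n c B i) (x (Suc i))"
    using assms unfolding connected_family_def by meson
  then show ?thesis using that[of \<rho>] by simp
qed

text \<open>Both reductions below are instances of this one: members of the span of \<open>B\<close>
  are divided by a fixed nowhere vanishing member and differentiated.\<close>

definition quotient_family ::
  "nat \<Rightarrow> (nat \<Rightarrow> real) \<Rightarrow> (nat \<Rightarrow> nat \<Rightarrow> real) \<Rightarrow> (nat \<Rightarrow> pw) \<Rightarrow> nat \<Rightarrow> pw"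
  where "quotient_family n \<alpha> \<beta> B = (\<lambda>l i. if i \<le> k then deriv_on (J i)
    (\<lambda>t. comb (Suc n) (\<beta> l) B i t / comb (Suc n) \<alpha> B i t) else 0)"

context
  fixes n :: nat and \<alpha> :: "nat \<Rightarrow> real" and \<beta> :: "nat \<Rightarrow> nat \<Rightarrow> real" and B :: "nat \<Rightarrow> pw"
  assumes n: "n \<ge> 1" and B: "smooth_family (Suc n) B" "connected_family (Suc n) B"
    and nz: "\<And>i t. i \<le> k \<Longrightarrow> t \<in> J i \<Longrightarrow> comb (Suc n) \<alpha> B i t \<noteq> 0"
begin

lemma smooth_quotient:
  assumes "i \<le> k"
  shows "smooth n (J i) (\<lambda>t. comb (Suc n) c B i t / comb (Suc n) \<alpha> B i t)"
  using assms nz by (intro smooth_divide perfect_J smooth_comb[OF B(1)]) auto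

lemma smooth_quotient_family: "smooth_family n (quotient_family n \<alpha> \<beta> B)"
proof -
  obtain p where p: "n = Suc p" using n by (cases n) auto
  show ?thesis
    using smooth_quotient by (auto simp: smooth_family_def quotient_family_def p)
qed

lemma comb_quotient_family:
  assumes "i \<le> k"
  shows "comb n c (quotient_family n \<alpha> \<beta> B) i = deriv_on (J i)
    (\<lambda>t. comb (Suc n) (\<lambda>q. \<Sum>l<n. c l * \<beta> l q) B i t / comb (Suc n) \<alpha> B i t)"
proof -
  obtain p where p: "n = Suc p" using n by (cases n) auto
  let ?q = "\<lambda>l t. comb (Suc n) (\<beta> l) B i t / comb (Suc n) \<alpha> B i t"
  have s: "smooth (Suc p) (J i) (?q l)" for l
    using smooth_quotient[OF assms] p by blast
  have "comb n c (quotient_family n \<alpha> \<beta> B) i = (\<lambda>t. \<Sum>l<n. c l * deriv_on (J i) (?q l) t)"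
    using assms by (simp add: comb_def[of n] quotient_family_def)
  also have "\<dots> = (\<lambda>t. \<Sum>l<n. deriv_on (J i) (\<lambda>t. c l * ?q l t) t)"
    using s by (subst deriv_on_cmult[OF perfect_J[OF assms]]) auto
  also have "\<dots> = deriv_on (J i) (\<lambda>t. \<Sum>l<n. c l * ?q l t)"
    using s by (intro deriv_on_sum[OF perfect_J[OF assms], symmetric]
        smooth_cmult[OF perfect_J[OF assms]])
  also have "\<dots> = deriv_on (J i)
      (\<lambda>t. comb (Suc n) (\<lambda>q. \<Sum>l<n. c l * \<beta> l q) B i t / comb (Suc n) \<alpha> B i t)"
  proof (intro arg_cong[where f = "deriv_on (J i)"] ext)
    fix t
    have "(\<Sum>q<Suc n. (\<Sum>l<n. c l * \<beta> l q) * B q i t) = (\<Sum>l<n. c l * comb (Suc n) (\<beta> l) B i t)"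
      unfolding sum_distrib_right comb_def sum_distrib_left
      by (subst sum.swap) (simp add: mult.assoc)
    then show "(\<Sum>l<n. c l * ?q l t) =
        comb (Suc n) (\<lambda>q. \<Sum>l<n. c l * \<beta> l q) B i t / comb (Suc n) \<alpha> B i t"
      by (simp add: comb_def[of "Suc n" "\<lambda>q. \<Sum>l<n. c l * \<beta> l q"] sum_divide_distrib)
  qed
  finally show ?thesis .
qed

lemma vanishes_quotient_family:
  fixes c :: "nat \<Rightarrow> real"
  assumes "i \<le> k" "t \<in> J i" "r \<le> n"
  defines "e \<equiv> \<lambda>q. \<Sum>l<n. c l * \<beta> l q"
  shows "vanishes (J i) r (comb n c (quotient_family n \<alpha> \<beta> B) i) t \<longleftrightarrow>
    vanishes (J i) (Suc r) (comb (Suc n)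
      (\<lambda>q. e q - comb (Suc n) e B i t / comb (Suc n) \<alpha> B i t * \<alpha> q) B i) t"
  unfolding comb_quotient_family[OF assms(1)] e_def[symmetric] comb_diff[symmetric]
  using assms n nz smooth_comb[OF B(1) assms(1)] by (intro vanishes_deriv_quotient perfect_J) auto

text \<open>The quotients \<open>F / u\<close> take equal values on both sides of a knot because
  numerator and denominator are multiplied by the same factor \<open>\<rho>0\<close>. So the same
  \<open>\<gamma>\<close> can be subtracted on both sides, and the leading derivatives of \<open>F -
  \<gamma> u\<close> are connected by a factor \<open>\<rho>\<close> coming from
  \<open>B\<close>.\<close>

lemma connected_quotient_family: "connected_family n (quotient_family n \<alpha> \<beta> B)"
  unfolding connected_family_def
proof (intro allI impI)
  fix i r assume i: "i < k" and r: "r < n"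
  let ?y = "x (Suc i)" and ?u = "comb (Suc n) \<alpha> B"
  obtain \<rho>0 where \<rho>0: "\<rho>0 > 0" "\<And>c. comb (Suc n) c B (Suc i) ?y = \<rho>0 * comb (Suc n) c B i ?y"
    using connected_values[OF B(2) i] by blast
  obtain \<rho> where \<rho>: "\<rho> > 0" "\<And>c. vanishes (J i) (Suc r) (comb (Suc n) c B i) ?y \<Longrightarrow>
      derivs_on (J (Suc i)) (Suc r) (comb (Suc n) c B (Suc i)) ?y =
      \<rho> * derivs_on (J i) (Suc r) (comb (Suc n) c B i) ?y"
    using B(2) i r unfolding connected_family_def by (metis Suc_less_eq)
  have y: "?y \<in> J i" "?y \<in> J (Suc i)" and u: "?u i ?y \<noteq> 0"
    using i right_J[of i] left_J[of i] nz[of i] by auto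
  have "derivs_on (J (Suc i)) r (comb n c (quotient_family n \<alpha> \<beta> B) (Suc i)) ?y =
      \<rho> / \<rho>0 * derivs_on (J i) r (comb n c (quotient_family n \<alpha> \<beta> B) i) ?y"
    if v: "vanishes (J i) r (comb n c (quotient_family n \<alpha> \<beta> B) i) ?y" for c
  proof -
    define e where "e = (\<lambda>q. \<Sum>l<n. c l * \<beta> l q)"
    define \<gamma> where "\<gamma> = comb (Suc n) e B i ?y / ?u i ?y"
    have \<gamma>': "\<gamma> = comb (Suc n) e B (Suc i) ?y / ?u (Suc i) ?y"
      using \<rho>0 u by (simp add: \<gamma>_def)
    let ?G = "comb (Suc n) (\<lambda>q. e q - \<gamma> * \<alpha> q) B"
    have G: "?G j = (\<lambda>s. comb (Suc n) e B j s - \<gamma> * ?u j s)" for j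
      by (simp add: comb_diff)
    have v1: "vanishes (J i) (Suc r) (?G i) ?y"
      using v vanishes_quotient_family[of i ?y r c] i y r by (simp add: e_def \<gamma>_def)
    then have v2: "vanishes (J (Suc i)) (Suc r) (?G (Suc i)) ?y"
      using connected_vanishes[OF B(2) i] r by simp
    have d1: "derivs_on (J i) r (comb n c (quotient_family n \<alpha> \<beta> B) i) ?y =
        derivs_on (J i) (Suc r) (?G i) ?y / ?u i ?y"
      unfolding comb_quotient_family[OF less_imp_le[OF i]] e_def[symmetric] G
      using i y nz r perfect_J smooth_comb[OF B(1)] v1[unfolded G]
      by (intro derivs_deriv_quotient[where f = "comb (Suc n) e B i" and u = "?u i" and
            t = ?y and n = n, folded \<gamma>_def]) auto
    have d2: "derivs_on (J (Suc i)) r (comb n c (quotient_family n \<alpha> \<beta> B) (Suc i)) ?y =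
        derivs_on (J (Suc i)) (Suc r) (?G (Suc i)) ?y / ?u (Suc i) ?y"
      unfolding comb_quotient_family[OF Suc_leI[OF i]] e_def[symmetric] G
      using i y nz r perfect_J smooth_comb[OF B(1)] v2[unfolded G]
      by (intro derivs_deriv_quotient[where f = "comb (Suc n) e B (Suc i)" and
            u = "?u (Suc i)" and t = ?y and n = n, folded \<gamma>']) auto
    show ?thesis
      unfolding d1 d2 \<rho>(2)[OF v1] using \<rho>0 u by simp
  qed
  then show "\<exists>\<rho>>0. \<forall>c. vanishes (J i) r (comb n c (quotient_family n \<alpha> \<beta> B) i) ?y \<longrightarrow>
      derivs_on (J (Suc i)) r (comb n c (quotient_family n \<alpha> \<beta> B) (Suc i)) ?y =
      \<rho> * derivs_on (J i) r (comb n c (quotient_family n \<alpha> \<beta> B) i) ?y"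
    using \<rho>(1) \<rho>0(1) by (intro exI[of _ "\<rho> / \<rho>0"]) simp
qed

end

section \<open>Signs of piecewise functions\<close>

lemma nonzero_same_sign:
  fixes g :: "real \<Rightarrow> real"
  assumes "is_interval I" "continuous_on I g" "\<forall>t\<in>I. g t \<noteq> 0" "s \<in> I" "t \<in> I"
  shows "g s * g t > 0"
proof (rule ccontr)
  assume "\<not> g s * g t > 0"
  then have "(g s \<le> 0 \<and> 0 \<le> g t) \<or> (g t \<le> 0 \<and> 0 \<le> g s)"
    by (auto simp: not_less mult_le_0_iff)
  moreover have "is_interval (g ` I)"
    using assms(1,2) connected_continuous_image is_interval_connected_1 by blast
  ultimately have "0 \<in> g ` I"
    using mem_is_interval_1_I[of "g ` I"] assms(4,5) by blast
  then show False using assms(3) by auto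
qed

lemma connected_nonzero_one_sign:
  assumes "connected_family n B" "l < n" "\<And>i. i \<le> k \<Longrightarrow> continuous_on (J i) (B l i)"
    "\<And>i t. i \<le> k \<Longrightarrow> t \<in> J i \<Longrightarrow> B l i t \<noteq> 0"
  obtains s where "\<And>i t. i \<le> k \<Longrightarrow> t \<in> J i \<Longrightarrow> s * B l i t > 0"
proof -
  let ?s = "B l 0 (x (Suc 0))"
  have "\<forall>t\<in>J i. ?s * B l i t > 0" if "i \<le> k" for i
    using that
  proof (induction i)
    case 0
    then show ?case
      using nonzero_same_sign[OF interval_J, of 0 "B l 0"] assms(3,4) right_J[of 0] by auto
  next
    case (Suc i)
    let ?y = "x (Suc i)"
    have i: "i < k" using Suc.prems by simp
    obtain \<rho> where \<rho>: "\<rho> > 0" "\<And>c. comb n c B (Suc i) ?y = \<rho> * comb n c B i ?y"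
      using connected_values[OF assms(1) i] assms(2) by auto
    have "?s * B l i ?y > 0" using Suc right_J[of i] by auto
    moreover have "?s * B l (Suc i) ?y = \<rho> * (?s * B l i ?y)"
      using \<rho>(2)[of "\<lambda>q. if q = l then 1 else 0"] comb_unit[OF assms(2), of B] by simp
    ultimately have a: "?s * B l (Suc i) ?y > 0" using \<rho>(1) by (metis mult_pos_pos)
    show ?case
    proof
      fix t assume "t \<in> J (Suc i)"
      then have "B l (Suc i) ?y * B l (Suc i) t > 0"
        using nonzero_same_sign[OF interval_J, of "Suc i" "B l (Suc i)" ?y t]
          assms(3,4) Suc.prems left_J[OF i] by blast
      with a show "?s * B l (Suc i) t > 0"
        by (metis zero_less_mult_pos zero_less_mult_iff mult.commute order_less_asym)
    qed
  qed
  then show ?thesis using that by blast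
qed

text \<open>Integration from the right end of the interval, where \<open>g\<close> is zero, back
  through the knots.\<close>

lemma sign_from_derivative:
  assumes "\<And>i. i \<le> k \<Longrightarrow> smooth (Suc p) (J i) (g i)"
    and knots: "\<And>i. i < k \<Longrightarrow> g (Suc i) (x (Suc i)) = g i (x (Suc i))"
    and deriv: "\<And>i t. i \<le> k \<Longrightarrow> t \<in> J i \<Longrightarrow> (i = k \<Longrightarrow> t < x (Suc k)) \<Longrightarrow>
      s * deriv_on (J i) (g i) t > 0"
    and last: "g k (x (Suc k)) = 0"
    and "i \<le> k" "t \<in> J i" "i = k \<Longrightarrow> t < x (Suc k)"
  shows "s * g i t < 0"
proof -
  have step: "s * g i t < 0" if h: "i \<le> k" "s * g i (x (Suc i)) \<le> 0" "t \<in> J i" "t < x (Suc i)" for i t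
  proof -
    obtain z where z: "t < z" "z < x (Suc i)" "z \<in> J i"
      "g i (x (Suc i)) - g i t = deriv_on (J i) (g i) z * (x (Suc i) - t)"
      using mvt_on[OF interval_J perfect_J[OF h(1)] assms(1)[OF h(1)] h(3) right_J[OF h(1)] h(4)]
      by blast
    have "0 < s * deriv_on (J i) (g i) z * (x (Suc i) - t)"
      using deriv[OF h(1) z(3)] z(2) h(4) by (intro mult_pos_pos[of "s * _"]) auto
    also have "\<dots> = s * (g i (x (Suc i)) - g i t)"
      unfolding z(4) by simp
    also have "\<dots> = s * g i (x (Suc i)) - s * g i t"
      by (rule right_diff_distrib)
    finally show ?thesis using h(2) by linarith
  qed
  show ?thesis
    using assms(5-)
  proof (induction "k - i" arbitrary: i t)
    case 0
    then have "i = k" by simp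
    with 0 show ?case using step[of k t] last by simp
  next
    case (Suc d)
    then have i: "i < k" by simp
    then have "s * g (Suc i) (x (Suc i)) < 0"
      using Suc.hyps(1)[of "Suc i" "x (Suc i)"] Suc.hyps(2) left_J[OF i] less[of "Suc i"]
      by (cases "Suc i = k") simp_all
    then have "s * g i (x (Suc i)) < 0" using knots[OF i] by simp
    then show ?case
      using step[of i t] i Suc.prems le_right_J[of t i] by (cases "t = x (Suc i)") auto
  qed
qed

end

section \<open>A rule of Descartes for flags of functions\<close>

context partition
begin

text \<open>Nonzero members of the span of \<open>B l, \<dots>, B (n - 1)\<close>, a space of
  dimension \<open>n - l\<close>, cannot vanish \<open>n - l\<close> times at the point
  \<open>t\<close>.\<close>

definition tail_independent :: "nat \<Rightarrow> (nat \<Rightarrow> pw) \<Rightarrow> nat \<Rightarrow> real \<Rightarrow> bool"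
  where "tail_independent n B i t \<longleftrightarrow> (\<forall>l<n. \<forall>c. (\<forall>h<l. c h = 0) \<longrightarrow>
    vanishes (J i) (n - l) (comb n c B i) t \<longrightarrow> (\<forall>h<n. c h = 0))"

lemma tail_independentD:
  assumes "tail_independent n B i t" "l < n" "\<And>h. h < l \<Longrightarrow> c h = 0"
    "vanishes (J i) (n - l) (comb n c B i) t" "h < n"
  shows "c h = 0"
proof -
  have "\<forall>h<l. c h = 0" using assms(3) by blast
  then show ?thesis using assms(1,2,4,5) unfolding tail_independent_def by blast
qed

text \<open>With \<open>vanishes (J k) (n - 1 - l) (B l k) (x (Suc k))\<close> the spans of the
  initial segments of \<open>B\<close> form the flag given by the order of vanishing at the right
  end, while tail independence concerns the final segments.\<close>

definition flag_family :: "nat \<Rightarrow> (nat \<Rightarrow> pw) \<Rightarrow> bool"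
  where "flag_family n B \<longleftrightarrow> smooth_family n B \<and> connected_family n B \<and>
    (\<forall>i\<le>k. \<forall>t\<in>J i. tail_independent n B i t) \<and>
    (\<forall>l<n. vanishes (J k) (n - 1 - l) (B l k) (x (Suc k)))"

text \<open>The derivatives of the quotients \<open>- B l / B n\<close>. A positive quotient that
  vanishes at the right end and has a derivative of one sign is decreasing, so the minus sign
  preserves positivity.\<close>

abbreviation reduced_family :: "nat \<Rightarrow> (nat \<Rightarrow> pw) \<Rightarrow> nat \<Rightarrow> pw"
  where "reduced_family n B \<equiv>
    quotient_family n (\<lambda>q. if q = n then 1 else 0) (\<lambda>l q. if q = l then - 1 else 0) B"

lemma last_nonzero:
  assumes "flag_family (Suc n) B" "i \<le> k" "t \<in> J i"
  shows "B n i t \<noteq> 0"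
proof
  let ?c = "\<lambda>q. if q = n then 1 else 0 :: real"
  assume "B n i t = 0"
  then have "vanishes (J i) (Suc n - n) (comb (Suc n) ?c B i) t"
    by (simp add: comb_unit)
  moreover have "tail_independent (Suc n) B i t"
    using assms by (simp add: flag_family_def)
  ultimately have "?c n = 0"
    using tail_independentD[of "Suc n" B i t n ?c n] by simp
  then show False by simp
qed

lemma reduced_coeffs:
  "(\<Sum>l<n. c l * (if q = l then - 1 else 0)) = (if q < n then - c q else (0::real))" for q :: nat
proof -
  have "(\<Sum>l<n. c l * (if q = l then - 1 else 0)) = (\<Sum>l<n. if q = l then - c l else 0)"
    by (intro sum.cong) auto
  then show ?thesis by simp
qed

lemma reduced_family_eq:
  assumes "flag_family (Suc n) B" "l < n" "i \<le> k"
  shows "reduced_family n B l i = deriv_on (J i) (\<lambda>t. - B l i t / B n i t)"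
proof -
  have "comb (Suc n) (\<lambda>q. if q = l then - 1 else 0) B i t = - B l i t" for t
    using comb_cmult[of "Suc n" "- 1" "\<lambda>q. if q = l then 1 else 0" B i t] comb_unit[of l "Suc n" B]
      assms(2) by (simp add: if_distrib[of uminus] cong: if_cong)
  then show ?thesis using assms(3) by (simp add: quotient_family_def comb_unit)
qed

text \<open>The last coefficient is at our disposal because \<open>B n / B n\<close> is
  constant.\<close>

lemma vanishes_reduced_iff:
  fixes c :: "nat \<Rightarrow> real"
  assumes "flag_family (Suc n) B" "n \<ge> 1" "i \<le> k" "t \<in> J i" "r \<le> n"
  defines "\<gamma> \<equiv> - comb n c B i t / B n i t"
  shows "vanishes (J i) r (comb n c (reduced_family n B) i) t \<longleftrightarrow>
    vanishes (J i) (Suc r) (comb (Suc n) (c(n := \<gamma>)) B i) t"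
proof -
  have nz: "comb (Suc n) (\<lambda>q. if q = n then 1 else 0) B i t \<noteq> 0" if "i \<le> k" "t \<in> J i" for i t
    using last_nonzero[OF assms(1) that] by (simp add: comb_unit)
  define e where "e = (\<lambda>q. if q < n then - c q else 0)"
  have "comb n e B i t = - comb n c B i t"
    using comb_cong[of n e "\<lambda>q. - 1 * c q" B] comb_cmult[of n "- 1" c B i t] by (simp add: e_def)
  then have \<gamma>: "\<gamma> = comb (Suc n) e B i t / comb (Suc n) (\<lambda>q. if q = n then 1 else 0) B i t"
    by (simp add: \<gamma>_def comb_unit) (simp add: comb_Suc e_def)
  have "vanishes (J i) r (comb n c (reduced_family n B) i) t \<longleftrightarrow> vanishes (J i) (Suc r)
      (comb (Suc n) (\<lambda>q. e q - \<gamma> * (if q = n then 1 else 0)) B i) t"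
    using vanishes_quotient_family[OF assms(2) _ _ nz assms(3,4,5), of c
        "\<lambda>l q. if q = l then - 1 else 0"] assms(1)
    by (simp only: reduced_coeffs flag_family_def e_def \<gamma>)
  also have "comb (Suc n) (\<lambda>q. e q - \<gamma> * (if q = n then 1 else 0)) B =
      comb (Suc n) (\<lambda>q. - 1 * (c(n := \<gamma>)) q) B"
    by (rule comb_cong) (auto simp: e_def)
  also have "comb (Suc n) (\<lambda>q. - 1 * (c(n := \<gamma>)) q) B i =
      (\<lambda>t. - 1 * comb (Suc n) (c(n := \<gamma>)) B i t)"
    by (rule ext) (rule comb_cmult)
  also have "vanishes (J i) (Suc r) \<dots> t \<longleftrightarrow>
      vanishes (J i) (Suc r) (comb (Suc n) (c(n := \<gamma>)) B i) t"
  proof -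
    have "smooth n (J i) (comb (Suc n) (c(n := \<gamma>)) B i)"
      using assms by (intro smooth_comb) (auto simp: flag_family_def)
    from derivs_on_cmult[OF perfect_J[OF assms(3)] this, of _ "- 1"] show ?thesis
      using assms(5) by (simp add: vanishes_def)
  qed
  finally show ?thesis .
qed

lemma flag_family_reduced:
  assumes B: "flag_family (Suc n) B" and n: "n \<ge> 1"
  shows "flag_family n (reduced_family n B)"
  unfolding flag_family_def
proof (intro conjI allI impI ballI)
  have nz: "comb (Suc n) (\<lambda>q. if q = n then 1 else 0) B i t \<noteq> 0" if "i \<le> k" "t \<in> J i" for i t
    using last_nonzero[OF B that] by (simp add: comb_unit)
  have Bs: "smooth_family (Suc n) B" "connected_family (Suc n) B"
    using B by (simp_all add: flag_family_def)
  show "smooth_family n (reduced_family n B)"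
    by (rule smooth_quotient_family[OF n Bs nz])
  show "connected_family n (reduced_family n B)"
    by (rule connected_quotient_family[OF n Bs nz])
  show "tail_independent n (reduced_family n B) i t" if i: "i \<le> k" "t \<in> J i" for i t
    unfolding tail_independent_def
  proof (intro allI impI)
    fix l c h assume l: "l < n" "\<forall>h<l. c h = 0" "h < n"
      and v: "vanishes (J i) (n - l) (comb n c (reduced_family n B) i) t"
    define \<gamma> where "\<gamma> = - comb n c B i t / B n i t"
    have "vanishes (J i) (Suc (n - l)) (comb (Suc n) (c(n := \<gamma>)) B i) t"
      using vanishes_reduced_iff[OF B n i, of "n - l" c] v by (simp add: \<gamma>_def)
    then have "vanishes (J i) (Suc n - l) (comb (Suc n) (c(n := \<gamma>)) B i) t"
      using l(1) by (simp add: Suc_diff_le)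
    moreover have "tail_independent (Suc n) B i t"
      using B i by (simp add: flag_family_def)
    ultimately have "(c(n := \<gamma>)) h = 0"
      using tail_independentD[of "Suc n" B i t l "c(n := \<gamma>)" h] l by auto
    then show "c h = 0" using l(3) by simp
  qed
  show "vanishes (J k) (n - 1 - l) (reduced_family n B l k) (x (Suc k))" if l: "l < n" for l
  proof -
    have s: "smooth n (J k) (B q k)" if "q < Suc n" for q
      using B that by (auto simp: flag_family_def smooth_family_def)
    have "vanishes (J k) (Suc (n - 1 - l)) (B l k) (x (Suc k))"
      using B l by (auto simp: flag_family_def Suc_diff_Suc)
    then have "vanishes (J k) (Suc (n - 1 - l)) (\<lambda>t. - 1 * B l k t) (x (Suc k))"
      using l derivs_on_cmult[OF perfect_J[of k] s[of l], of _ "- 1"] by (auto simp: vanishes_def)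
    moreover have "smooth n (J k) (\<lambda>t. - 1 * B l k t)"
      using s[of l] l by (intro smooth_cmult perfect_J) auto
    ultimately have "vanishes (J k) (Suc (n - 1 - l)) (\<lambda>t. - 1 * B l k t / B n k t) (x (Suc k))"
      using last_nonzero[OF B, of k] s[of n]
      by (subst vanishes_divide_iff[of "J k" _ n]) (auto simp: perfect_J right_J)
    then have "vanishes (J k) (n - 1 - l) (deriv_on (J k) (\<lambda>t. - 1 * B l k t / B n k t)) (x (Suc k))"
      unfolding vanishes_Suc_deriv by blast
    then show ?thesis
      using reduced_family_eq[OF B l, of k] by simp
  qed
qed

lemma flag_quotient_sign:
  assumes B: "flag_family (Suc n) B" and l: "l < n"
    and s: "\<And>i t. i \<le> k \<Longrightarrow> t \<in> J i \<Longrightarrow> (i = k \<Longrightarrow> t < x (Suc k)) \<Longrightarrow>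
      s * reduced_family n B l i t > 0"
    and it: "i \<le> k" "t \<in> J i" "i = k \<Longrightarrow> t < x (Suc k)"
  shows "s * (B l i t / B n i t) > 0"
proof -
  obtain p where p: "n = Suc p" using l by (cases n) auto
  let ?g = "\<lambda>i t. - B l i t / B n i t"
  have sm: "smooth n (J i) (B q i)" if "q < Suc n" "i \<le> k" for q i
    using B that by (auto simp: flag_family_def smooth_family_def)
  have "s * ?g i t < 0"
  proof (rule sign_from_derivative[where g = ?g and p = p])
    show "smooth (Suc p) (J i) (?g i)" if "i \<le> k" for i
    proof -
      have "smooth n (J i) (\<lambda>t. - 1 * B l i t / B n i t)"
        using that sm[of l i] sm[of n i] l last_nonzero[OF B that]
        by (intro smooth_divide smooth_cmult perfect_J) auto
      then show ?thesis by (simp add: p)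
    qed
    show "?g (Suc i) (x (Suc i)) = ?g i (x (Suc i))" if i: "i < k" for i
    proof -
      have "connected_family (Suc n) B" using B by (simp add: flag_family_def)
      then obtain \<rho> where \<rho>: "\<rho> > 0"
        "\<And>c. comb (Suc n) c B (Suc i) (x (Suc i)) = \<rho> * comb (Suc n) c B i (x (Suc i))"
        using connected_values[OF _ i] by blast
      have "B q (Suc i) (x (Suc i)) = \<rho> * B q i (x (Suc i))" if "q < Suc n" for q
        using \<rho>(2)[of "\<lambda>r. if r = q then 1 else 0"] comb_unit[OF that, of B] by simp
      then show ?thesis using \<rho>(1) l by simp
    qed
    show "s * deriv_on (J i) (?g i) t > 0" if "i \<le> k" "t \<in> J i" "i = k \<Longrightarrow> t < x (Suc k)" for i t
      using s[OF that] reduced_family_eq[OF B l that(1)] by simp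
    have "vanishes (J k) (Suc (n - 1 - l)) (B l k) (x (Suc k))"
      using B l by (auto simp: flag_family_def Suc_diff_Suc)
    then show "?g k (x (Suc k)) = 0"
      unfolding vanishes_Suc_deriv by simp
  qed (use it in auto)
  then show ?thesis by simp
qed

text \<open>By induction \<open>B l / B n\<close> has a derivative of one sign, and it vanishes at
  the right end, so the quotient itself has one sign. For the last member the sign passes through
  the knots because the connection factors are positive.\<close>

lemma flag_one_sign:
  assumes "flag_family n B" "l < n"
  obtains s where "\<And>i t. i \<le> k \<Longrightarrow> t \<in> J i \<Longrightarrow> (i = k \<Longrightarrow> t < x (Suc k)) \<Longrightarrow> s * B l i t > 0"
proof -
  have "\<exists>s. \<forall>i t. i \<le> k \<longrightarrow> t \<in> J i \<longrightarrow> (i = k \<longrightarrow> t < x (Suc k)) \<longrightarrow> s * B l i t > 0"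
    using assms
  proof (induction n arbitrary: B l)
    case (Suc n)
    note B = Suc.prems(1)
    have "continuous_on (J i) (B n i)" if "i \<le> k" for i
      using B that by (auto simp: flag_family_def smooth_family_def intro: smooth_continuous)
    then obtain s1 where s1: "\<And>i t. i \<le> k \<Longrightarrow> t \<in> J i \<Longrightarrow> s1 * B n i t > 0"
      using connected_nonzero_one_sign[of "Suc n" B n] B last_nonzero[OF B]
      unfolding flag_family_def by (metis lessI)
    show ?case
    proof (cases "l = n")
      case True
      then show ?thesis using s1 by blast
    next
      case False
      then have l: "l < n" using Suc.prems by simp
      then have "flag_family n (reduced_family n B)"
        using flag_family_reduced[OF B] by simp
      from Suc.IH[OF this l] obtain s2 where s2: "\<And>i t. i \<le> k \<Longrightarrow> t \<in> J i \<Longrightarrow>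
          (i = k \<Longrightarrow> t < x (Suc k)) \<Longrightarrow> s2 * reduced_family n B l i t > 0"
        by blast
      have "s1 * s2 * B l i t > 0" if "i \<le> k" "t \<in> J i" "i = k \<longrightarrow> t < x (Suc k)" for i t
      proof -
        have "s2 * (B l i t / B n i t) > 0"
          using flag_quotient_sign[OF B l s2] that by blast
        then have "(s1 * B n i t) * (s2 * (B l i t / B n i t)) > 0"
          using s1[OF that(1,2)] by (rule mult_pos_pos[rotated])
        then show ?thesis
          using last_nonzero[OF B that(1,2)] by (simp add: field_simps)
      qed
      then show ?thesis by blast
    qed
  qed simp
  then show ?thesis using that by blast
qed

text \<open>A combination whose first \<open>p\<close> coefficients have a common strict sign cannot
  vanish more than \<open>n - p\<close> times at one point, although the other coefficients are
  arbitrary. Each reduction removes the last member of the family and one zero, and it keeps the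
  other coefficients and the positivity of the members; when only the first \<open>p\<close> members
  are left, all terms have the same strict sign unless \<open>\<gamma> = 0\<close>.\<close>

lemma positive_flag_descartes:
  assumes "flag_family n B"
    and "\<And>l i t. l < n \<Longrightarrow> i \<le> k \<Longrightarrow> t \<in> J i \<Longrightarrow> (i = k \<Longrightarrow> t < x (Suc k)) \<Longrightarrow> B l i t > 0"
    and "\<And>l. \<alpha> l > 0" "1 \<le> p" "p \<le> n" "\<And>h. h < p \<Longrightarrow> e h = \<gamma> * \<alpha> h"
    and "i \<le> k" "t \<in> J i" "i = k \<Longrightarrow> t < x (Suc k)"
    and "vanishes (J i) (Suc (n - p)) (comb n e B i) t"
  shows "\<gamma> = 0"
  using assms
proof (induction n arbitrary: B e)
  case (Suc n)
  note B = Suc.prems(1) and pos = Suc.prems(2)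
  show ?case
  proof (cases "p = Suc n")
    case True
    \<comment> \<open>No arbitrary coefficients are left: the combination is \<open>\<gamma>\<close> times a positive one.\<close>
    have "comb (Suc n) e B i t = \<gamma> * comb (Suc n) \<alpha> B i t"
      using comb_cong[of "Suc n" e "\<lambda>h. \<gamma> * \<alpha> h" B] Suc.prems(6) True comb_cmult[of "Suc n" \<gamma> \<alpha> B i t]
      by metis
    moreover have "comb (Suc n) e B i t = 0"
      using Suc.prems(10) True by simp
    moreover have "comb (Suc n) \<alpha> B i t > 0"
      unfolding comb_def using pos[of _ i t] Suc.prems(3,7,8,9) by (intro sum_pos) auto
    ultimately show ?thesis by simp
  next
    case False
    then have p: "p \<le> n" and n: "n \<ge> 1" using Suc.prems(4,5) by auto
    have fl: "flag_family n (reduced_family n B)"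
      by (rule flag_family_reduced[OF B n])
    have "reduced_family n B l j u > 0"
      if l: "l < n" and ju: "j \<le> k" "u \<in> J j" "j = k \<Longrightarrow> u < x (Suc k)" for l j u
    proof -
      obtain s where s: "\<And>i t. i \<le> k \<Longrightarrow> t \<in> J i \<Longrightarrow> (i = k \<Longrightarrow> t < x (Suc k)) \<Longrightarrow>
          s * reduced_family n B l i t > 0"
        using flag_one_sign[OF fl l] by blast
      have "s * (B l j u / B n j u) > 0"
        by (rule flag_quotient_sign[OF B l s ju])
      moreover have "B l j u / B n j u > 0"
        using pos[of l j u] pos[of n j u] l ju by simp
      ultimately have "s > 0" by (rule zero_less_mult_pos2)
      then show ?thesis using s[OF ju] by (rule zero_less_mult_pos[rotated])
    qed
    moreover have "vanishes (J i) (Suc (n - p)) (comb n e (reduced_family n B) i) t"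
    proof -
      have v: "vanishes (J i) (Suc (Suc (n - p))) (comb (Suc n) e B i) t"
        using Suc.prems(10) p by (simp add: Suc_diff_le)
      then have "comb n e B i t + e n * B n i t = 0"
        unfolding vanishes_Suc_deriv comb_Suc by blast
      then have "- comb n e B i t / B n i t = e n"
        using last_nonzero[OF B Suc.prems(7,8)] by (simp add: field_simps)
      then show ?thesis
        using vanishes_reduced_iff[OF B n Suc.prems(7,8), of "Suc (n - p)" e] p Suc.prems(4) v
        by simp
    qed
    ultimately show ?thesis
      using Suc.IH[OF fl _ Suc.prems(3,4) p Suc.prems(6-9)] by blast
  qed
qed simp

end

section \<open>Bernstein-like families\<close>

lemma (in partition) derivs_comb:
  assumes "smooth_family (Suc n) B" "i \<le> k" "r \<le> n"
  shows "derivs_on (J i) r (comb (Suc n) c B i) t =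
    (\<Sum>l<Suc n. c l * derivs_on (J i) r (B l i) t)"
proof -
  have s: "smooth n (J i) (B l i)" if "l < Suc n" for l
    using assms that by (simp add: smooth_family_def)
  have "derivs_on (J i) r (\<lambda>t. \<Sum>l<Suc n. c l * B l i t) t =
      (\<Sum>l<Suc n. derivs_on (J i) r (\<lambda>t. c l * B l i t) t)"
    using derivs_on_sum[OF perfect_J[OF assms(2)], of "Suc n" n "\<lambda>l t. c l * B l i t" r]
      smooth_cmult[OF perfect_J[OF assms(2)] s] assms(3) by simp
  also have "\<dots> = (\<Sum>l<Suc n. c l * derivs_on (J i) r (B l i) t)"
    using derivs_on_cmult[OF perfect_J[OF assms(2)] s assms(3)] by (intro sum.cong) auto
  finally show ?thesis unfolding comb_def .
qed

locale knots =
  fixes k :: nat and x :: "nat \<Rightarrow> real"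
  assumes knots_less: "i \<le> k \<Longrightarrow> x i < x (Suc i)"
begin

text \<open>The last member of a Bernstein-like family of at least two functions vanishes at
  \<open>x 0\<close>, so the reduction of the previous section is available only away from that
  point.\<close>

definition half_piece :: "nat \<Rightarrow> real set"
  where "half_piece i = (if i = 0 then {x 0<..x (Suc 0)} else piece x i)"

sublocale closed: partition k x "piece x"
  by standard (use knots_less in auto)

sublocale half: partition k x half_piece
  by standard (use knots_less in \<open>auto simp: half_piece_def\<close>)

lemma knots_le: "i \<le> j \<Longrightarrow> j \<le> Suc k \<Longrightarrow> x i \<le> x j"
proof (induction j)
  case (Suc j)
  then show ?case using knots_less[of j] by (cases "i = Suc j") auto
qed simp

lemma half_piece_iff: "i \<le> k \<Longrightarrow> t \<in> half_piece i \<longleftrightarrow> t \<in> piece x i \<and> x 0 < t"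
proof (cases i)
  case (Suc j)
  assume "i \<le> k"
  then have "x 0 < x i" using knots_less[of 0] knots_le[of 1 i] Suc by auto
  then show ?thesis by (auto simp: half_piece_def piece_def Suc)
qed (auto simp: half_piece_def piece_def)

lemma before_end_iff:
  assumes "i \<le> k" "t \<in> piece x i"
  shows "(i = k \<longrightarrow> t < x (Suc k)) \<longleftrightarrow> t < x (Suc k)"
proof (cases "i = k")
  case False
  then have "x (Suc i) \<le> x k" "x k < x (Suc k)"
    using assms(1) knots_le[of "Suc i" k] knots_less[of k] by auto
  then show ?thesis using assms False by (auto simp: piece_def)
qed simp

lemma half_derivs:
  assumes "closed.smooth_family n B" "i \<le> k" "t \<in> half_piece i" "r \<le> n"
  shows "vanishes (half_piece i) r (comb n c B i) t \<longleftrightarrow> vanishes (piece x i) r (comb n c B i) t"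
    and "r < n \<Longrightarrow>
      derivs_on (half_piece i) r (comb n c B i) t = derivs_on (piece x i) r (comb n c B i) t"
proof -
  have *: "derivs_on (half_piece i) q (comb n c B i) t = derivs_on (piece x i) q (comb n c B i) t"
    if q: "q < n" for q
  proof -
    obtain p where p: "n = Suc p" using q by (cases n) auto
    have sub: "half_piece i \<subseteq> piece x i" using half_piece_iff[OF assms(2)] by blast
    show ?thesis
      using derivs_on_subset(2)[OF closed.perfect_J[OF assms(2)] half.perfect_J[OF assms(2)] sub
          closed.smooth_comb[OF assms(1)[unfolded p] assms(2)] assms(3), of q c] q p by simp
  qed
  then show "vanishes (half_piece i) r (comb n c B i) t \<longleftrightarrow>
      vanishes (piece x i) r (comb n c B i) t"
    using assms(4) by (simp add: vanishes_def)
  show "r < n \<Longrightarrow>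
      derivs_on (half_piece i) r (comb n c B i) t = derivs_on (piece x i) r (comb n c B i) t"
    by (rule *)
qed

text \<open>The zero pattern of a Bernstein basis, with order exactly \<open>l\<close> at the left
  end and order at least \<open>n - 1 - l\<close> at the right end, where tail independence makes
  the order exact. Zeros are bounded at one point at a time, in the form of tail independence,
  because this form passes to the next space.\<close>

definition bernstein_like :: "nat \<Rightarrow> (nat \<Rightarrow> pw) \<Rightarrow> bool"
  where "bernstein_like n B \<longleftrightarrow> closed.smooth_family n B \<and> closed.connected_family n B \<and>
    (\<forall>i\<le>k. \<forall>t\<in>piece x i. x 0 < t \<longrightarrow> closed.tail_independent n B i t) \<and>
    (\<forall>l<n. vanishes (piece x k) (n - 1 - l) (B l k) (x (Suc k))) \<and>
    (\<forall>l<n. vanishes (piece x 0) l (B l 0) (x 0) \<and> \<not> vanishes (piece x 0) (Suc l) (B l 0) (x 0))"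

definition positive_inside :: "nat \<Rightarrow> (nat \<Rightarrow> pw) \<Rightarrow> bool"
  where "positive_inside n B \<longleftrightarrow>
    (\<forall>l<n. \<forall>i\<le>k. \<forall>t\<in>piece x i. x 0 < t \<longrightarrow> t < x (Suc k) \<longrightarrow> B l i t > 0)"

lemma bernstein_like_flag:
  assumes B: "bernstein_like n B"
  shows "half.flag_family n B"
proof -
  have sm: "closed.smooth_family n B" and cn: "closed.connected_family n B"
    using B by (simp_all add: bernstein_like_def)
  have "half.smooth_family n B"
    unfolding half.smooth_family_def
  proof (intro allI impI)
    fix l i assume l: "l < n" and i: "i \<le> k"
    have sub: "half_piece i \<subseteq> piece x i" using half_piece_iff[OF i] by blast
    have "smooth (n - 1) (piece x i) (B l i)"
      using sm l i by (simp add: closed.smooth_family_def)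
    then show "smooth (n - 1) (half_piece i) (B l i)"
      by (rule derivs_on_subset(1)[OF closed.perfect_J[OF i] half.perfect_J[OF i] sub])
  qed
  moreover have "half.connected_family n B"
    unfolding half.connected_family_def
  proof (intro allI impI)
    fix i r assume i: "i < k" and r: "r < n"
    have y: "x (Suc i) \<in> half_piece i" "x (Suc i) \<in> half_piece (Suc i)"
      using half.right_J[of i] half.left_J[of i] i by auto
    have "\<exists>\<rho>>0. \<forall>c. vanishes (piece x i) r (comb n c B i) (x (Suc i)) \<longrightarrow>
        derivs_on (piece x (Suc i)) r (comb n c B (Suc i)) (x (Suc i)) =
        \<rho> * derivs_on (piece x i) r (comb n c B i) (x (Suc i))"
      using cn i r unfolding closed.connected_family_def by blast
    then show "\<exists>\<rho>>0. \<forall>c. vanishes (half_piece i) r (comb n c B i) (x (Suc i)) \<longrightarrow>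
        derivs_on (half_piece (Suc i)) r (comb n c B (Suc i)) (x (Suc i)) =
        \<rho> * derivs_on (half_piece i) r (comb n c B i) (x (Suc i))"
      using half_derivs[OF sm _ y(1)] half_derivs[OF sm _ y(2)] i r by simp
  qed
  moreover have "half.tail_independent n B i t" if i: "i \<le> k" "t \<in> half_piece i" for i t
  proof -
    have "closed.tail_independent n B i t"
      using B i half_piece_iff[OF i(1)] by (simp add: bernstein_like_def)
    then show ?thesis
      using half_derivs(1)[OF sm i] by (simp add: closed.tail_independent_def half.tail_independent_def)
  qed
  moreover have "vanishes (half_piece k) (n - 1 - l) (B l k) (x (Suc k))" if l: "l < n" for l
  proof -
    have "vanishes (piece x k) (n - 1 - l) (B l k) (x (Suc k))"
      using B l by (simp add: bernstein_like_def)
    then show ?thesis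
      using half_derivs(1)[OF sm _ half.right_J, of k "n - 1 - l" "\<lambda>q. if q = l then 1 else 0"] l
      by (simp add: comb_unit)
  qed
  ultimately show ?thesis
    unfolding half.flag_family_def by blast
qed

text \<open>Each member of a Bernstein-like family has one sign inside the interval, so one positive
  value decides.\<close>

lemma positive_insideI:
  assumes B: "bernstein_like n B"
    and "\<And>l. l < n \<Longrightarrow> \<exists>i\<le>k. \<exists>t\<in>piece x i. x 0 < t \<and> t < x (Suc k) \<and> B l i t > 0"
  shows "positive_inside n B"
  unfolding positive_inside_def
proof (intro allI impI ballI)
  fix l i t assume l: "l < n" and it: "i \<le> k" "t \<in> piece x i" "x 0 < t" "t < x (Suc k)"
  obtain s where s: "\<And>i t. i \<le> k \<Longrightarrow> t \<in> half_piece i \<Longrightarrow> (i = k \<Longrightarrow> t < x (Suc k)) \<Longrightarrow>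
      s * B l i t > 0"
    using half.flag_one_sign[OF bernstein_like_flag[OF B] l] by blast
  obtain j u where ju: "j \<le> k" "u \<in> piece x j" "x 0 < u" "u < x (Suc k)" "B l j u > 0"
    using assms(2)[OF l] by blast
  have "s * B l j u > 0"
    using s[OF ju(1)] half_piece_iff[OF ju(1)] ju by blast
  then have "s > 0" using ju(5) by (rule zero_less_mult_pos2)
  moreover have "s * B l i t > 0"
    using s[OF it(1)] half_piece_iff[OF it(1)] it by blast
  ultimately show "B l i t > 0" by (rule zero_less_mult_pos[rotated])
qed

lemma positive_inside_nonneg:
  assumes B: "bernstein_like n B" "positive_inside n B" and l: "l < n" and it: "i \<le> k" "t \<in> piece x i"
  shows "B l i t \<ge> 0"
proof -
  have less: "x i < x (Suc i)" using knots_less[OF it(1)] .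
  have cl: "closure {x i<..<x (Suc i)} = piece x i"
    using less by (simp add: piece_def)
  have "continuous_on (piece x i) (B l i)"
    using B(1) l it(1) unfolding bernstein_like_def closed.smooth_family_def
    by (blast intro: smooth_continuous)
  moreover have "B l i u \<ge> 0" if "u \<in> {x i<..<x (Suc i)}" for u
  proof -
    have "x 0 \<le> x i" "x (Suc i) \<le> x (Suc k)"
      using it(1) knots_le[of 0 i] knots_le[of "Suc i" "Suc k"] by auto
    then have "B l i u > 0"
      using B(2) l it(1) that unfolding positive_inside_def by (auto simp: piece_def)
    then show ?thesis by simp
  qed
  ultimately show ?thesis
    using continuous_ge_on_closure[of "{x i<..<x (Suc i)}" "B l i" t 0] it(2) unfolding cl by blast
qed

lemma bernstein_like_at_a:
  assumes "bernstein_like n B" "l < n"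
  shows "B l 0 (x 0) = 0 \<longleftrightarrow> l > 0"
proof (cases l)
  case 0
  then show ?thesis using assms by (auto simp: bernstein_like_def)
next
  case (Suc j)
  have "vanishes (piece x 0) l (B l 0) (x 0)"
    using assms by (simp add: bernstein_like_def)
  then show ?thesis unfolding Suc vanishes_Suc_deriv by simp
qed

lemma sum_positive:
  assumes B: "bernstein_like (Suc n) B" "positive_inside (Suc n) B" and it: "i \<le> k" "t \<in> piece x i"
  shows "(\<Sum>l<Suc n. B l i t) > 0"
proof -
  have nonneg: "B l i t \<ge> 0" if "l < Suc n" for l
    using positive_inside_nonneg[OF B that it] .
  have "\<exists>l<Suc n. B l i t \<noteq> 0"
  proof -
    have t: "x 0 \<le> t" "t \<le> x (Suc k)"
      using it knots_le[of 0 i] knots_le[of "Suc i" "Suc k"] by (auto simp: piece_def)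
    consider "x 0 < t" "t < x (Suc k)" | "t = x 0" | "x 0 < t" "t = x (Suc k)" using t by linarith
    then show ?thesis
    proof cases
      case 1
      then have "B 0 i t > 0" using B(2) it by (simp add: positive_inside_def)
      then show ?thesis by (intro exI[of _ 0]) simp
    next
      case 2
      then have "i = 0"
        using it(2) half_piece_iff[OF it(1), of t] by (cases "i = 0") (simp_all add: half_piece_def)
      then show ?thesis
        using bernstein_like_at_a[OF B(1), of 0] 2 by (intro exI[of _ 0]) simp
    next
      case 3
      then have "i = k" using before_end_iff[OF it] by auto
      have "t \<in> half_piece i" using half_piece_iff[OF it(1)] it(2) 3 by blast
      then have "B n i t \<noteq> 0"
        by (rule half.last_nonzero[OF bernstein_like_flag[OF B(1)] it(1)])
      then show ?thesis by blast
    qed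
  qed
  then obtain l where "l < Suc n" "B l i t \<noteq> 0" by blast
  then show ?thesis
    using nonneg by (intro sum_pos2[of "{..<Suc n}" l]) (auto simp: order_less_le)
qed

text \<open>At the right end the members with index below \<open>l\<close> vanish to the order in
  question by themselves, which leaves a combination of the final segment.\<close>

lemma end_coefficients:
  assumes B: "bernstein_like (Suc n) B" and l: "l < Suc n"
    and v: "vanishes (piece x k) (Suc n - l) (comb (Suc n) d B k) (x (Suc k))"
    and q: "l \<le> q" "q < Suc n"
  shows "d q = 0"
proof -
  let ?b = "x (Suc k)"
  have sm: "closed.smooth_family (Suc n) B" using B by (simp add: bernstein_like_def)
  let ?d = "\<lambda>q. if q < l then 0 else d q"
  have "vanishes (piece x k) (Suc n - l) (comb (Suc n) ?d B k) ?b"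
    unfolding vanishes_def
  proof (intro allI impI)
    fix r assume r: "r < Suc n - l"
    have "derivs_on (piece x k) r (B j k) ?b = 0" if "j < l" for j
    proof -
      have "vanishes (piece x k) (Suc n - 1 - j) (B j k) ?b"
        using B that l by (simp add: bernstein_like_def)
      then show ?thesis using r that by (simp add: vanishes_def)
    qed
    then have "(\<Sum>j<Suc n. ?d j * derivs_on (piece x k) r (B j k) ?b) =
        (\<Sum>j<Suc n. d j * derivs_on (piece x k) r (B j k) ?b)"
      by (intro sum.cong) auto
    also have "\<dots> = 0"
      using v r closed.derivs_comb[OF sm, of k r d ?b] unfolding vanishes_def by simp
    finally show "derivs_on (piece x k) r (comb (Suc n) ?d B k) ?b = 0"
      using closed.derivs_comb[OF sm, of k r ?d ?b] r by simp
  qed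
  moreover have "closed.tail_independent (Suc n) B k ?b"
    using B closed.right_J[of k] knots_less[of k] knots_le[of 0 k] by (auto simp: bernstein_like_def)
  ultimately have "?d q = 0"
    using closed.tail_independentD[of "Suc n" B k ?b l ?d q] l q(2) by simp
  then show ?thesis using q(1) by simp
qed

text \<open>With \<open>w\<close> the sum of \<open>B 0, \<dots>, B n\<close>, the member with index
  \<open>l\<close> is the derivative of \<open>(B (l + 1) + \<dots> + B n) / w\<close>, the
  derivative of a transition function of the quotient space.\<close>

abbreviation step_family :: "nat \<Rightarrow> (nat \<Rightarrow> pw) \<Rightarrow> nat \<Rightarrow> pw"
  where "step_family n B \<equiv>
    closed.quotient_family n (\<lambda>q. 1) (\<lambda>l q. if l < q then 1 else 0) B"

lemma step_coeffs:
  fixes q n :: nat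
  assumes "q \<le> n"
  shows "(\<Sum>l<n. c l * (if l < q then 1 else 0)) = (\<Sum>l<q. c l :: real)"
proof -
  have "(\<Sum>l<n. c l * (if l < q then 1 else 0)) = (\<Sum>l\<in>{..<n}. if l \<in> {..<q} then c l else 0)"
    by (intro sum.cong) auto
  also have "\<dots> = (\<Sum>l\<in>{..<n} \<inter> {..<q}. c l)"
    using sum.inter_restrict[of "{..<n}" c "{..<q}"] by simp
  also have "{..<n} \<inter> {..<q} = {..<q}"
    using assms by auto
  finally show ?thesis .
qed

context
  fixes n :: nat and B :: "nat \<Rightarrow> pw"
  assumes n: "n \<ge> 1" and B: "bernstein_like (Suc n) B" "positive_inside (Suc n) B"
begin

lemma weight_pos: "i \<le> k \<Longrightarrow> t \<in> piece x i \<Longrightarrow> comb (Suc n) (\<lambda>q. 1) B i t > 0"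
  using sum_positive[OF B] by (simp add: comb_def)

lemma smooth_B: "closed.smooth_family (Suc n) B" and connected_B: "closed.connected_family (Suc n) B"
  using B(1) by (simp_all add: bernstein_like_def)

lemma weight_nz: "i \<le> k \<Longrightarrow> t \<in> piece x i \<Longrightarrow> comb (Suc n) (\<lambda>q. 1) B i t \<noteq> 0"
  using weight_pos by force

lemma vanishes_step:
  assumes "i \<le> k" "t \<in> piece x i" "r \<le> n"
  defines "e \<equiv> \<lambda>c q. \<Sum>l<q. c l"
  shows "vanishes (piece x i) r (comb n c (step_family n B) i) t \<longleftrightarrow>
    vanishes (piece x i) (Suc r) (comb (Suc n) (\<lambda>q. e c q -
      comb (Suc n) (e c) B i t / comb (Suc n) (\<lambda>q. 1) B i t) B i) t"
proof -
  let ?e = "\<lambda>q. \<Sum>l<n. c l * (if l < q then 1 else 0)"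
  have 1: "comb (Suc n) ?e B = comb (Suc n) (e c) B"
    by (intro comb_cong) (simp add: e_def step_coeffs)
  have 2: "comb (Suc n) (\<lambda>q. ?e q - a) B = comb (Suc n) (\<lambda>q. e c q - a) B" for a
    by (intro comb_cong) (simp add: e_def step_coeffs)
  show ?thesis
    using closed.vanishes_quotient_family[OF n smooth_B connected_B weight_nz assms(1-3),
        of c "\<lambda>l q. if l < q then 1 else 0"]
    unfolding 1 mult_1_right 2 .
qed

text \<open>If a combination of the final segment of the new family vanishes \<open>n - l\<close>
  times at \<open>t\<close>, then \<open>F - \<gamma> w\<close> vanishes \<open>n + 1 - l\<close>
  times there, for some \<open>F\<close> in the span of \<open>B (l + 1), \<dots>, B n\<close>. Its
  coefficients with index at most \<open>l\<close> are all equal to \<open>- \<gamma>\<close>; this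
  is where it matters that \<open>w\<close> has positive coefficients. The rule of Descartes, or the
  count at the right end, yields \<open>\<gamma> = 0\<close>, after which the tail independence of
  \<open>B\<close> applies to \<open>F\<close>.\<close>

lemma tail_independent_step:
  assumes it: "i \<le> k" "t \<in> piece x i" "x 0 < t"
  shows "closed.tail_independent n (step_family n B) i t"
  unfolding closed.tail_independent_def
proof (intro allI impI)
  fix l c h
  assume l: "l < n" and c: "\<forall>h<l. c h = 0" and h: "h < n"
    and v: "vanishes (piece x i) (n - l) (comb n c (step_family n B) i) t"
  define e where "e = (\<lambda>q. \<Sum>l<q. c l)"
  define \<gamma> where "\<gamma> = comb (Suc n) e B i t / comb (Suc n) (\<lambda>q. 1) B i t"
  have e0: "e q = 0" if "q \<le> l" for q
    using c that unfolding e_def by (intro sum.neutral) auto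
  have v1: "vanishes (piece x i) (Suc n - l) (comb (Suc n) (\<lambda>q. e q - \<gamma>) B i) t"
    using vanishes_step[OF it(1,2), of "n - l" c] v l by (simp add: e_def \<gamma>_def Suc_diff_le)
  have "e q = 0" if q: "q < Suc n" for q
  proof (cases "i = k \<and> t = x (Suc k)")
    case True
    then have d: "e q - \<gamma> = 0" if "l \<le> q" "q < Suc n" for q
      using end_coefficients[OF B(1), of l "\<lambda>q. e q - \<gamma>" q] v1 l that by simp
    have "\<gamma> = 0" using d[of l] e0[of l] l by simp
    then show ?thesis using d[of q] e0[of q] q by (cases "l \<le> q") auto
  next
    case False
    then have lt: "i = k \<Longrightarrow> t < x (Suc k)" using it(2) by (auto simp: piece_def)
    have hp: "t \<in> half_piece i" using half_piece_iff[OF it(1)] it by blast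
    \<comment> \<open>The first \<open>l + 1\<close> coefficients of \<open>F - \<gamma> w\<close> equal \<open>- \<gamma>\<close>.\<close>
    have "- \<gamma> = 0"
    proof (rule half.positive_flag_descartes[where n = "Suc n" and B = B and \<alpha> = "\<lambda>q. 1"
          and p = "Suc l" and e = "\<lambda>q. e q - \<gamma>" and i = i and t = t])
      show "half.flag_family (Suc n) B" by (rule bernstein_like_flag[OF B(1)])
      show "B l i t > 0" if "l < Suc n" "i \<le> k" "t \<in> half_piece i" "i = k \<Longrightarrow> t < x (Suc k)" for l i t
        using B(2) that half_piece_iff[OF that(2)] before_end_iff[OF that(2)]
        unfolding positive_inside_def by blast
      show "vanishes (half_piece i) (Suc (Suc n - Suc l)) (comb (Suc n) (\<lambda>q. e q - \<gamma>) B i) t"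
        using half_derivs(1)[OF smooth_B it(1) hp, of "Suc (Suc n - Suc l)"] v1 l
        by (simp add: Suc_diff_le)
      show "e h - \<gamma> = - \<gamma> * 1" if "h < Suc l" for h
        using e0[of h] that by simp
    qed (use l it hp lt in auto)
    then have "vanishes (piece x i) (Suc n - l) (comb (Suc n) e B i) t"
      using v1 by simp
    then have "vanishes (piece x i) (Suc n - Suc l) (comb (Suc n) e B i) t"
      by (rule vanishes_mono) simp
    moreover have "closed.tail_independent (Suc n) B i t"
      using B(1) it by (simp add: bernstein_like_def)
    ultimately show ?thesis
      using closed.tail_independentD[of "Suc n" B i t "Suc l" e q] e0 l q by simp
  qed
  from this[of h] this[of "Suc h"] show "c h = 0"
    using h by (simp add: e_def)
qed

lemma unit_sum: "(\<Sum>j<q. if j = l then 1 else 0) = (if l < q then 1 else 0 :: real)" for l q :: nat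
  by simp

lemma vanishes_step_member:
  assumes "i \<le> k" "t \<in> piece x i" "r \<le> n" "l < n"
  defines "e \<equiv> \<lambda>q. if l < q then 1 else 0 :: real"
  shows "vanishes (piece x i) r (step_family n B l i) t \<longleftrightarrow>
    vanishes (piece x i) (Suc r) (comb (Suc n) (\<lambda>q. e q -
      comb (Suc n) e B i t / comb (Suc n) (\<lambda>q. 1) B i t) B i) t"
  using vanishes_step[OF assms(1-3), of "\<lambda>q. if q = l then 1 else 0"]
  unfolding comb_unit[OF assms(4)] unit_sum e_def .

lemma step_at_b:
  assumes l: "l < n"
  shows "vanishes (piece x k) (n - 1 - l) (step_family n B l k) (x (Suc k))"
proof -
  let ?b = "x (Suc k)"
  define e where "e = (\<lambda>q. if l < q then 1 else 0 :: real)"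
  have dB: "derivs_on (piece x k) r (B q k) ?b = 0" if "q \<le> l" "r < n - l" for q r
  proof -
    have "vanishes (piece x k) (n - q) (B q k) ?b"
      using B(1) that l by (simp add: bernstein_like_def)
    then show ?thesis using that by (simp add: vanishes_def)
  qed
  have "comb (Suc n) e B k ?b = comb (Suc n) (\<lambda>q. 1) B k ?b"
    unfolding comb_def e_def using dB[of _ 0] l by (intro sum.cong) auto
  then have g: "comb (Suc n) e B k ?b / comb (Suc n) (\<lambda>q. 1) B k ?b = 1"
    using weight_nz[of k ?b] closed.right_J[of k] by simp
  have "vanishes (piece x k) (Suc (n - 1 - l)) (comb (Suc n) (\<lambda>q. e q - 1) B k) ?b"
    unfolding vanishes_def
  proof (intro allI impI)
    fix r assume r: "r < Suc (n - 1 - l)"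
    have "(\<Sum>q<Suc n. (e q - 1) * derivs_on (piece x k) r (B q k) ?b) = 0"
      using dB r l by (intro sum.neutral) (auto simp: e_def)
    then show "derivs_on (piece x k) r (comb (Suc n) (\<lambda>q. e q - 1) B k) ?b = 0"
      using closed.derivs_comb[OF smooth_B, of k r] r by simp
  qed
  then show ?thesis
    using vanishes_step_member[of k ?b "n - 1 - l" l] closed.right_J[of k] l g
    unfolding e_def by simp
qed

lemma step_at_a:
  assumes l: "l < n"
  shows "vanishes (piece x 0) l (step_family n B l 0) (x 0)"
    and "\<not> vanishes (piece x 0) (Suc l) (step_family n B l 0) (x 0)"
proof -
  let ?a = "x 0"
  define e where "e = (\<lambda>q. if l < q then 1 else 0 :: real)"
  have a: "?a \<in> piece x 0" using knots_less[of 0] by (simp add: piece_def)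
  have v: "vanishes (piece x 0) q (B q 0) ?a" if "q < Suc n" for q
    using B(1) that by (simp add: bernstein_like_def)
  then have dB: "derivs_on (piece x 0) r (B q 0) ?a = 0" if "r < q" "q < Suc n" for q r
    using that by (simp add: vanishes_def)
  have "comb (Suc n) e B 0 ?a = 0"
    unfolding comb_def e_def using dB[of 0] by (intro sum.neutral) auto
  then have eq: "vanishes (piece x 0) r (step_family n B l 0) ?a \<longleftrightarrow>
      vanishes (piece x 0) (Suc r) (comb (Suc n) e B 0) ?a" if "r \<le> n" for r
    using vanishes_step_member[OF _ a that l] by (simp add: e_def)
  have d: "derivs_on (piece x 0) r (comb (Suc n) e B 0) ?a = 0" if "r \<le> l" for r
  proof -
    have "(\<Sum>q<Suc n. e q * derivs_on (piece x 0) r (B q 0) ?a) = 0"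
      using dB that by (intro sum.neutral) (auto simp: e_def)
    then show ?thesis
      using closed.derivs_comb[OF smooth_B, of 0 r e] that l by simp
  qed
  then show "vanishes (piece x 0) l (step_family n B l 0) ?a"
    using eq[of l] l by (simp add: vanishes_def)
  have "derivs_on (piece x 0) (Suc l) (comb (Suc n) e B 0) ?a =
      (\<Sum>q<Suc n. e q * derivs_on (piece x 0) (Suc l) (B q 0) ?a)"
    using closed.derivs_comb[OF smooth_B, of 0 "Suc l" e] l by simp
  also have "\<dots> = (\<Sum>q<Suc n. if q = Suc l then derivs_on (piece x 0) (Suc l) (B q 0) ?a else 0)"
    using dB[of "Suc l"] by (intro sum.cong) (auto simp: e_def simp del: funpow.simps)
  also have "\<dots> = derivs_on (piece x 0) (Suc l) (B (Suc l) 0) ?a"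
    using l by simp
  also have "\<dots> \<noteq> 0"
  proof -
    have "\<not> vanishes (piece x 0) (Suc (Suc l)) (B (Suc l) 0) ?a"
      using B(1) l by (simp add: bernstein_like_def)
    then show ?thesis using v[of "Suc l"] l unfolding vanishes_Suc[of _ "Suc l"] by simp
  qed
  finally show "\<not> vanishes (piece x 0) (Suc l) (step_family n B l 0) ?a"
    using eq[of "Suc l"] l unfolding vanishes_Suc[of _ "Suc l"] by simp
qed

text \<open>Positivity needs one positive value of each derivative: the tail quotient is
  \<open>0\<close> at the left end and positive inside, so it increases somewhere in the first
  piece.\<close>

theorem bernstein_step: "bernstein_like n (step_family n B)" "positive_inside n (step_family n B)"
proof -
  show *: "bernstein_like n (step_family n B)"
    unfolding bernstein_like_def
    using closed.smooth_quotient_family[OF n smooth_B connected_B weight_nz]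
      closed.connected_quotient_family[OF n smooth_B connected_B weight_nz]
      tail_independent_step step_at_a step_at_b by blast
  show "positive_inside n (step_family n B)"
  proof (rule positive_insideI[OF *])
    fix l assume l: "l < n"
    let ?e = "\<lambda>q. if l < q then 1 else 0 :: real"
    define f where "f = (\<lambda>t. comb (Suc n) ?e B 0 t / comb (Suc n) (\<lambda>q. 1) B 0 t)"
    define t where "t = (x 0 + x (Suc 0)) / 2"
    have less: "x 0 < x (Suc 0)" "x (Suc 0) \<le> x (Suc k)"
      using knots_less[of 0] knots_le[of 1 "Suc k"] by auto
    have t: "x 0 < t" "t < x (Suc 0)" using less by (auto simp: t_def)
    have pc: "x 0 \<in> piece x 0" "t \<in> piece x 0" using t less by (auto simp: piece_def)
    obtain p where p: "n = Suc p" using n by (cases n) auto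
    have "smooth (Suc p) (piece x 0) f"
      using closed.smooth_quotient[OF n smooth_B connected_B weight_nz, of 0 ?e] p by (simp add: f_def)
    from mvt_on[OF closed.interval_J closed.perfect_J[of 0] this pc t(1)]
    obtain z where z: "x 0 < z" "z < t" "z \<in> piece x 0"
      "f t - f (x 0) = deriv_on (piece x 0) f z * (t - x 0)" by auto
    have "comb (Suc n) ?e B 0 (x 0) = 0"
      unfolding comb_def using bernstein_like_at_a[OF B(1)] by (intro sum.neutral) auto
    moreover have "comb (Suc n) ?e B 0 t > 0"
    proof -
      have "B q 0 t > 0" if "q < Suc n" for q
        using B(2) that pc t less unfolding positive_inside_def by auto
      then show ?thesis
        unfolding comb_def using l by (intro sum_pos2[of _ "Suc l"]) (auto simp: less_imp_le)
    qed
    ultimately have "f (x 0) = 0" "f t > 0"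
      using weight_pos[of 0 t] pc by (simp_all add: f_def)
    then have "f t - f (x 0) > 0" by linarith
    then have "deriv_on (piece x 0) f z * (t - x 0) > 0" by (simp only: z(4))
    then have "deriv_on (piece x 0) f z > 0" using t(1) by (simp only: zero_less_mult_pos2 diff_gt_0_iff_gt)
    then have "step_family n B l 0 z > 0"
      by (simp add: closed.quotient_family_def f_def)
    then show "\<exists>i\<le>k. \<exists>t\<in>piece x i. x 0 < t \<and> t < x (Suc k) \<and> step_family n B l i t > 0"
      using z t less by (intro exI[of _ 0] conjI bexI[of _ z]) auto
  qed
qed

end

end

section \<open>Weights and generalized derivatives\<close>

context knots
begin

lemma pieces_equal_derivative:
  assumes sm: "\<And>i. i \<le> k \<Longrightarrow> smooth (Suc p) (piece x i) (g i)"
      "\<And>i. i \<le> k \<Longrightarrow> smooth (Suc p) (piece x i) (h i)"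
    and d: "\<And>i t. i \<le> k \<Longrightarrow> t \<in> piece x i \<Longrightarrow> deriv_on (piece x i) (g i) t = deriv_on (piece x i) (h i) t"
    and kn: "\<And>i. i < k \<Longrightarrow> g (Suc i) (x (Suc i)) = g i (x (Suc i))"
      "\<And>i. i < k \<Longrightarrow> h (Suc i) (x (Suc i)) = h i (x (Suc i))"
    and a: "g 0 (x 0) = h 0 (x 0)"
    and it: "i \<le> k" "t \<in> piece x i"
  shows "g i t = h i t"
proof -
  have step: "g i t = h i t" if i: "i \<le> k" "g i (x i) = h i (x i)" "t \<in> piece x i" for i t
  proof (cases "t = x i")
    case False
    then have lt: "x i < t" using i(3) by (simp add: piece_def)
    let ?f = "\<lambda>s. g i s - 1 * h i s"
    have m: "x i \<in> piece x i" using knots_less[OF i(1)] by (simp add: piece_def)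
    have s: "smooth (Suc p) (piece x i) ?f"
      by (rule smooth_diff_cmult[OF closed.perfect_J[OF i(1)] sm(1)[OF i(1)] sm(2)[OF i(1)]])
    from mvt_on[OF closed.interval_J closed.perfect_J[OF i(1)] s m i(3) lt]
    obtain z where z: "z \<in> piece x i" "?f t - ?f (x i) = deriv_on (piece x i) ?f z * (t - x i)"
      by blast
    have "((\<lambda>s. g i s - h i s) has_real_derivative
        deriv_on (piece x i) (g i) z - deriv_on (piece x i) (h i) z) (at z within piece x i)"
      using sm[OF i(1)] z(1) by (intro DERIV_diff deriv_on_works) auto
    then have "deriv_on (piece x i) ?f z = 0"
      using deriv_on_eqI[OF closed.perfect_J[OF i(1)] z(1)] d[OF i(1) z(1)] by simp
    then show ?thesis using z(2) i(2) by simp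
  qed (use i in simp)
  have "g i (x i) = h i (x i)" if "i \<le> k" for i
    using that
  proof (induction i)
    case (Suc i)
    then have "g i (x (Suc i)) = h i (x (Suc i))"
      using step[of i "x (Suc i)"] closed.right_J[of i] by simp
    then show ?case using kn[of i] Suc.prems by simp
  qed (use a in simp)
  then show ?thesis using step it by blast
qed

lemma smooth_gen_deriv:
  assumes v: "weight_system k x n v" and F: "F \<in> pw_C (n - 1) k x" and "j < n" "i \<le> k"
  shows "smooth (n - 1 - j) (piece x i) (gen_deriv k x v j F i)"
  using assms(3)
proof (induction j)
  case 0
  have "smooth (n - 1) (piece x i) (v 0 i)" "\<forall>t\<in>piece x i. v 0 i t \<noteq> 0"
    using v 0 assms(4) by (force simp: weight_system_def pw_C_def C_on_iff pw_positive_def)+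
  then show ?case
    using F assms(4) by (auto simp: pw_divide_def pw_C_def C_on_iff intro!: smooth_divide closed.perfect_J)
next
  case (Suc j)
  obtain p where p: "n - 1 - j = Suc p" "n - Suc j - 1 = p" "n - 1 - Suc j = p"
    using Suc.prems by (cases "n - 1 - j") auto
  have "smooth (n - Suc j - 1) (piece x i) (v (Suc j) i)" "\<forall>t\<in>piece x i. v (Suc j) i t \<noteq> 0"
    using v Suc.prems assms(4) by (force simp: weight_system_def pw_C_def C_on_iff pw_positive_def)+
  moreover have "smooth p (piece x i) (deriv_on (piece x i) (gen_deriv k x v j F i))"
    using Suc p(1) by simp
  ultimately show ?case
    using assms(4) unfolding p by (auto simp: pw_divide_def pw_deriv_def intro!: smooth_divide closed.perfect_J)
qed

text \<open>From the last generalized derivative, which is constant, down to the function itself: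
  equal derivatives, equal initial values and continuity at the knots give equal functions.\<close>

lemma ECP_eqI:
  assumes v: "weight_system k x n v" and n: "n \<ge> 1" and FG: "F \<in> ECP k x n v" "G \<in> ECP k x n v"
    and a: "\<And>j. j < n \<Longrightarrow> gen_deriv k x v j F 0 (x 0) = gen_deriv k x v j G 0 (x 0)"
  shows "F = G"
proof -
  have C: "F \<in> pw_C (n - 1) k x" "G \<in> pw_C (n - 1) k x" using FG by (simp_all add: ECP_def)
  have nz: "v j i t \<noteq> 0" if "j < n" "i \<le> k" "t \<in> piece x i" for j i t
    using v that by (force simp: weight_system_def pw_positive_def)
  have eq: "gen_deriv k x v (n - 1 - j) F i t = gen_deriv k x v (n - 1 - j) G i t"
    if "j < n" "i \<le> k" "t \<in> piece x i" for j i t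
    using that
  proof (induction j arbitrary: i t)
    case 0
    have "x 0 \<in> piece x 0" using knots_less[of 0] by (simp add: piece_def)
    moreover obtain c d where "\<forall>i\<le>k. \<forall>t\<in>piece x i. gen_deriv k x v (n - 1) F i t = c"
      "\<forall>i\<le>k. \<forall>t\<in>piece x i. gen_deriv k x v (n - 1) G i t = d"
      using FG unfolding ECP_def by blast
    ultimately show ?case using a[of "n - 1"] n 0 by simp
  next
    case (Suc j)
    let ?q = "n - 1 - Suc j"
    let ?D = "gen_deriv k x v ?q"
    have q: "n - 1 - j = Suc ?q" "Suc ?q < n" "?q < n" using Suc.prems by auto
    obtain p where p: "n - 1 - ?q = Suc p" using q by (cases "n - 1 - ?q") auto
    have d: "deriv_on (piece x i) (?D F i) t = deriv_on (piece x i) (?D G i) t"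
      if "i \<le> k" "t \<in> piece x i" for i t
      using Suc.IH[of i t] Suc.prems(1) that nz[OF q(2) that] unfolding q(1)
      by (simp add: pw_divide_def pw_deriv_def)
    have kn: "?D H (Suc i) (x (Suc i)) = ?D H i (x (Suc i))" if H: "H \<in> ECP k x n v" and i: "i < k" for H i
    proof -
      have "\<forall>i\<in>{1..k}. \<forall>j<n. gen_deriv k x v j H i (x i) = gen_deriv k x v j H (i - 1) (x i)"
        using H by (simp add: ECP_def)
      then show ?thesis using i q(3) by (metis Suc_leI atLeastAtMost_iff diff_Suc_1 le_add1 plus_1_eq_Suc)
    qed
    show ?case
    proof (rule pieces_equal_derivative[where p = p and g = "?D F" and h = "?D G"])
      show "smooth (Suc p) (piece x i) (?D F i)" "smooth (Suc p) (piece x i) (?D G i)" if "i \<le> k" for i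
        using smooth_gen_deriv[OF v C(1) q(3) that] smooth_gen_deriv[OF v C(2) q(3) that]
        unfolding p .
    qed (use d kn FG a q(3) Suc.prems in auto)
  qed
  have "F i t = G i t" for i t
  proof (cases "i \<le> k \<and> t \<in> piece x i")
    case True
    then show ?thesis
      using eq[of "n - 1" i t] nz[of 0 i t] n by (simp add: pw_divide_def)
  next
    case False
    have out: "H i t = 0" if "H \<in> pw_C (n - 1) k x" for H
      using that False by (cases "i \<le> k") (auto simp: pw_C_def C_on_def)
    show ?thesis unfolding out[OF C(1)] out[OF C(2)] ..
  qed
  then show ?thesis by (intro ext)
qed

text \<open>The bases of the successive derived spaces; the sum of \<open>level n B j\<close> is the
  weight with index \<open>j\<close>.\<close>

primrec level :: "nat \<Rightarrow> (nat \<Rightarrow> pw) \<Rightarrow> nat \<Rightarrow> nat \<Rightarrow> pw"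
  where
    "level n B 0 = B"
  | "level n B (Suc j) = step_family (n - Suc j) (level n B j)"

definition fdiff :: "(nat \<Rightarrow> real) \<Rightarrow> nat \<Rightarrow> real"
  where "fdiff c = (\<lambda>l. c (Suc l) - c l)"

lemma fdiff_surj:
  fixes y :: "nat \<Rightarrow> real"
  shows "\<exists>c. \<forall>j<n. (fdiff ^^ j) c 0 = y j"
proof (induction n arbitrary: y)
  case (Suc n)
  from Suc[of "\<lambda>j. y (Suc j)"] obtain c where c: "\<forall>j<n. (fdiff ^^ j) c 0 = y (Suc j)" by blast
  \<comment> \<open>The sequence with initial value \<open>y 0\<close> and differences \<open>c\<close>.\<close>
  define d where "d = (\<lambda>l. y 0 + (\<Sum>q<l. c q))"
  have "fdiff d = c" by (simp add: fdiff_def d_def)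
  then have "(fdiff ^^ Suc j) d = (fdiff ^^ j) c" for j
    by (simp only: funpow_Suc_right o_apply)
  then have "(fdiff ^^ j) d 0 = y j" if "j < Suc n" for j
    using c that by (cases j) (simp_all add: d_def del: funpow.simps(2))
  then show ?case by blast
qed simp

text \<open>Summation by parts: \<open>e 0 B 0 + \<dots> + e n B n\<close> is \<open>e 0 w\<close>
  plus the sum of the tails \<open>B (l + 1) + \<dots> + B n\<close> with the coefficients \<open>e
  (l + 1) - e l\<close>.\<close>

lemma deriv_weighted_comb:
  assumes "n \<ge> 1" "bernstein_like (Suc n) B" "positive_inside (Suc n) B" "i \<le> k"
  shows "deriv_on (piece x i) (\<lambda>t. comb (Suc n) e B i t / comb (Suc n) (\<lambda>q. 1) B i t) =
    comb n (fdiff e) (step_family n B) i"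
proof -
  let ?w = "comb (Suc n) (\<lambda>q. 1) B i"
  let ?E = "\<lambda>q. \<Sum>l<n. fdiff e l * (if l < q then 1 else 0)"
  note B = assms(1-3)
  have sm: "closed.smooth_family (Suc n) B" using assms(2) by (simp add: bernstein_like_def)
  have nz: "\<forall>t\<in>piece x i. ?w t \<noteq> 0"
    using weight_nz[OF B assms(4)] by blast
  obtain p where p: "n = Suc p" using assms(1) by (cases n) auto
  have E: "comb (Suc n) ?E B i t = comb (Suc n) e B i t - e 0 * ?w t" for t
  proof -
    have "comb (Suc n) ?E B = comb (Suc n) (\<lambda>q. e q - e 0 * 1) B"
    proof (rule comb_cong)
      fix q assume "q < Suc n"
      then have "?E q = (\<Sum>l<q. fdiff e l)" by (intro step_coeffs) simp
      also have "\<dots> = e q - e 0 * 1"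
        unfolding fdiff_def by (simp add: sum_lessThan_telescope)
      finally show "?E q = e q - e 0 * 1" .
    qed
    then show ?thesis by (simp only: comb_diff)
  qed
  have "comb n (fdiff e) (step_family n B) i = deriv_on (piece x i) (\<lambda>t. comb (Suc n) ?E B i t / ?w t)"
    by (rule closed.comb_quotient_family[OF assms(1) smooth_B[OF B] connected_B[OF B] weight_nz[OF B] assms(4)])
  also have "\<dots> = deriv_on (piece x i) (\<lambda>t. (comb (Suc n) e B i t - e 0 * ?w t) / ?w t)"
    unfolding E ..
  also have "\<dots> = deriv_on (piece x i) (\<lambda>t. comb (Suc n) e B i t / ?w t)"
    using closed.smooth_comb[OF sm assms(4)] unfolding p
    by (intro deriv_on_divide_shift[OF closed.perfect_J[OF assms(4)] nz[unfolded p], symmetric]) auto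
  finally show ?thesis ..
qed

context
  fixes n :: nat and B :: "nat \<Rightarrow> pw" and v :: "nat \<Rightarrow> pw"
  assumes n: "n \<ge> 1" and B: "bernstein_like n B" "positive_inside n B"
    and C: "\<And>l. l < n \<Longrightarrow> B l \<in> pw_C (n - 1) k x"
    and v: "\<And>j. j < n \<Longrightarrow> v j = comb (n - j) (\<lambda>q. 1) (level n B j)"
begin

lemma level_bernstein:
  "j < n \<Longrightarrow> bernstein_like (n - j) (level n B j) \<and> positive_inside (n - j) (level n B j)"
proof (induction j)
  case (Suc j)
  then have "n - j = Suc (n - Suc j)" "n - Suc j \<ge> 1" by auto
  then show ?case using Suc bernstein_step[of "n - Suc j" "level n B j"] by simp
qed (use B in simp)

lemma level_outside:
  assumes "j < n" "l < n - j" "\<not> (i \<le> k \<and> t \<in> piece x i)"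
  shows "level n B j l i t = 0"
proof (cases j)
  case 0
  then show ?thesis using C[of l] assms by (cases "i \<le> k") (auto simp: pw_C_def C_on_def)
next
  case (Suc q)
  then show ?thesis
    using assms(3) by (cases "i \<le> k") (simp_all add: closed.quotient_family_def deriv_on_outside)
qed

lemma comb_level_outside:
  "j < n \<Longrightarrow> \<not> (i \<le> k \<and> t \<in> piece x i) \<Longrightarrow> comb (n - j) c (level n B j) i t = 0"
  unfolding comb_def by (intro sum.neutral) (simp add: level_outside)

lemma comb_level_pw_C:
  assumes "j < n"
  shows "comb (n - j) c (level n B j) \<in> pw_C (n - j - 1) k x"
proof -
  obtain p where p: "n - j = Suc p" using assms by (cases "n - j") auto
  have "closed.smooth_family (n - j) (level n B j)"
    using level_bernstein[OF assms] by (simp add: bernstein_like_def)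
  then have "smooth (n - j - 1) (piece x i) (comb (n - j) c (level n B j) i)" if "i \<le> k" for i
    using closed.smooth_comb[of p "level n B j" i c] that by (simp add: p)
  moreover have "comb (n - j) c (level n B j) i = 0" if "i > k" for i
    using comb_level_outside[OF assms, of i] that by (auto simp: fun_eq_iff)
  ultimately show ?thesis
    using comb_level_outside[OF assms] by (auto simp: pw_C_def C_on_iff)
qed

lemma level_weight_pos:
  assumes "j < n" "i \<le> k" "t \<in> piece x i"
  shows "v j i t > 0"
proof -
  obtain p where p: "n - j = Suc p" using assms by (cases "n - j") auto
  then show ?thesis
    using sum_positive[of p "level n B j" i t] level_bernstein[OF assms(1)] assms
    by (simp add: v comb_def)
qed

lemma level_weight_system: "weight_system k x n v"
  unfolding weight_system_def pw_positive_def
  using comb_level_pw_C level_weight_pos v by simp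

lemma gen_deriv_level:
  assumes "j < n" "i \<le> k"
  shows "gen_deriv k x v j (comb n c B) i t = comb (n - j) ((fdiff ^^ j) c) (level n B j) i t / v j i t"
  using assms
proof (induction j arbitrary: i t)
  case (Suc j)
  let ?p = "n - Suc j"
  have p: "n - j = Suc ?p" "?p \<ge> 1" "j < n" using Suc.prems by auto
  let ?L = "level n B j"
  have L: "bernstein_like (Suc ?p) ?L" "positive_inside (Suc ?p) ?L"
    using level_bernstein[OF p(3)] unfolding p(1) by blast+
  have "gen_deriv k x v j (comb n c B) i =
      (\<lambda>t. comb (Suc ?p) ((fdiff ^^ j) c) ?L i t / comb (Suc ?p) (\<lambda>q. 1) ?L i t)"
    using Suc.IH[OF p(3) Suc.prems(2)] v[OF p(3)] unfolding p(1) by (intro ext) simp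
  then show ?case
    using deriv_weighted_comb[OF p(2) L Suc.prems(2), of "(fdiff ^^ j) c"] Suc.prems(2)
    by (simp add: pw_divide_def pw_deriv_def)
qed (simp add: pw_divide_def)

text \<open>Only the first member of each basis is nonzero at the left end. Hence the initial values
  of the generalized derivatives are iterated differences of the coefficients, which can be
  prescribed.\<close>

lemma gen_deriv_level_at_a:
  assumes "j < n"
  shows "gen_deriv k x v j (comb n c B) 0 (x 0) = (fdiff ^^ j) c 0"
proof -
  let ?L = "level n B j"
  have a: "?L l 0 (x 0) = 0" if "l < n - j" "l > 0" for l
    using bernstein_like_at_a[of "n - j" ?L l] level_bernstein[OF assms] that by simp
  have *: "comb (n - j) e ?L 0 (x 0) = e 0 * ?L 0 0 (x 0)" for e
  proof -
    have "comb (n - j) e ?L 0 (x 0) = (\<Sum>l<n - j. if l = 0 then e 0 * ?L 0 0 (x 0) else 0)"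
      unfolding comb_def using a by (intro sum.cong) auto
    then show ?thesis using assms by simp
  qed
  have "x 0 \<in> piece x 0" using knots_less[of 0] by (simp add: piece_def)
  then have "v j 0 (x 0) > 0" using level_weight_pos[OF assms, of 0] by simp
  then show ?thesis
    using gen_deriv_level[OF assms, of 0 c] *[of "(fdiff ^^ j) c"] *[of "\<lambda>q. 1"] v[OF assms]
    by simp
qed

lemma comb_in_ECP: "comb n c B \<in> ECP k x n v"
  unfolding ECP_def
proof (intro CollectI conjI ballI allI impI)
  show "comb n c B \<in> pw_C (n - 1) k x" using comb_level_pw_C[of 0 c] n by simp
  have last: "gen_deriv k x v (n - 1) (comb n c B) i t = (fdiff ^^ (n - 1)) c 0"
    if "i \<le> k" "t \<in> piece x i" for i t
  proof -
    have j: "n - 1 < n" "n - (n - 1) = 1" using n by auto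
    then show ?thesis
      using gen_deriv_level[OF j(1) that(1), of c t] level_weight_pos[OF j(1) that] v[OF j(1)] 
      unfolding j(2) by (simp add: comb_def)
  qed
  show "\<exists>c'. \<forall>i\<le>k. \<forall>t\<in>piece x i. gen_deriv k x v (n - 1) (comb n c B) i t = c'"
    using last by blast
  fix i j assume "i \<in> {1..k}" and j: "j < n"
  then obtain q where q: "i = Suc q" "q < k" by (cases i) auto
  have "closed.connected_family (n - j) (level n B j)" "n - j > 0"
    using level_bernstein[OF j] j by (auto simp: bernstein_like_def)
  then obtain \<rho> where "\<rho> > 0" "\<And>c. comb (n - j) c (level n B j) (Suc q) (x (Suc q)) =
      \<rho> * comb (n - j) c (level n B j) q (x (Suc q))"
    using closed.connected_values[of "n - j" "level n B j" q] q(2) by blast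
  then show "gen_deriv k x v j (comb n c B) i (x i) = gen_deriv k x v j (comb n c B) (i - 1) (x i)"
    using q gen_deriv_level[OF j, of _ c] v[OF j] by simp
qed

theorem range_comb_eq_ECP: "{comb n c B |c. True} = ECP k x n v"
proof (intro subset_antisym subsetI)
  fix F assume F: "F \<in> ECP k x n v"
  obtain c where c: "\<forall>j<n. (fdiff ^^ j) c 0 = gen_deriv k x v j F 0 (x 0)"
    using fdiff_surj[of n "\<lambda>j. gen_deriv k x v j F 0 (x 0)"] by blast
  have "F = comb n c B"
    using c gen_deriv_level_at_a
    by (intro ECP_eqI[OF level_weight_system n F comb_in_ECP]) simp
  then show "F \<in> {comb n c B |c. True}" by blast
qed (use comb_in_ECP in blast)

end

end

section \<open>The derivative of the spline space\<close>

lemma sum_pw_apply: "(\<Sum>l\<in>A. F l :: pw) i t = (\<Sum>l\<in>A. F l i t)"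
  by (induction A rule: infinite_finite_induct) (simp_all add: plus_fun_def zero_fun_def)

lemma comb_eq_sum: "comb n c B = (\<Sum>l<n. c l *\<^sub>R B l)"
  by (intro ext) (simp add: comb_def sum_pw_apply scaleR_fun_def)

lemma comb_in_subspace:
  assumes "subspace E" "\<And>l. l < n \<Longrightarrow> B l \<in> E"
  shows "comb n c B \<in> E"
  unfolding comb_eq_sum using assms by (intro subspace_sum subspace_scale) auto

lemma zero_mult_ge:
  assumes "vanishes J r f t" "r \<le> n"
  shows "r \<le> zero_mult J n f t"
  unfolding zero_mult_def using assms by (intro Max_ge) (auto simp: vanishes_def)

lemma total_mult_ge_two:
  assumes "total_mult T \<mu> \<le> enat N" "s \<in> T" "t \<in> T" "s \<noteq> t"
  shows "\<mu> s + \<mu> t \<le> N"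
proof -
  let ?Z = "{t \<in> T. \<mu> t \<noteq> 0}"
  have fin: "finite ?Z" and le: "sum \<mu> ?Z \<le> N"
    using assms(1) by (auto simp: total_mult_def split: if_splits)
  have "\<mu> s + \<mu> t = sum \<mu> {s, t}" using assms(4) by simp
  also have "\<dots> \<le> sum \<mu> (?Z \<union> {s, t})" using fin by (intro sum_mono2) auto
  also have "\<dots> = sum \<mu> ?Z" using fin assms by (intro sum.mono_neutral_right) auto
  finally show ?thesis using le by simp
qed

context knots
begin

lemma piece_index_eq:
  assumes "j \<le> k" "x j \<le> t" "j < k \<Longrightarrow> t < x (Suc j)"
  shows "piece_index k x t = j"
  unfolding piece_index_def
proof (rule Max_eqI)
  fix i assume "i \<in> {i. i \<le> k \<and> x i \<le> t}"
  then show "i \<le> j"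
    using assms(3) knots_le[of "Suc j" i] by (cases "i \<le> j") auto
qed (use assms in auto)

lemma first_in_piece: "x 0 \<in> piece x 0" and last_in_piece: "x (Suc k) \<in> piece x k"
  using knots_less[of 0] knots_less[of k] by (simp_all add: piece_def)

lemma piece_bounds:
  assumes "i \<le> k" "t \<in> piece x i"
  shows "t \<in> {x 0..x (Suc k)}"
  using assms knots_le[of 0 i] knots_le[of "Suc i" "Suc k"] by (auto simp: piece_def)

lemma rising_derivative:
  assumes sm: "\<And>i. i \<le> k \<Longrightarrow> smooth (Suc p) (piece x i) (g i)"
    and kn: "\<And>i. i < k \<Longrightarrow> g (Suc i) (x (Suc i)) = g i (x (Suc i))"
    and rise: "g 0 (x 0) < g k (x (Suc k))"
  obtains i z where "i \<le> k" "z \<in> piece x i" "x 0 < z" "z < x (Suc k)" "deriv_on (piece x i) (g i) z > 0"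
proof (rule ccontr)
  note found = that
  assume no: "\<not> thesis"
  have step: "g i (x (Suc i)) \<le> g i (x i)" if i: "i \<le> k" for i
  proof (rule ccontr)
    assume up: "\<not> g i (x (Suc i)) \<le> g i (x i)"
    have mem: "x i \<in> piece x i" "x (Suc i) \<in> piece x i"
      using knots_less[OF i] by (simp_all add: piece_def)
    from mvt_on[OF closed.interval_J closed.perfect_J[OF i] sm[OF i] mem knots_less[OF i]]
    obtain z where z: "x i < z" "z < x (Suc i)" "z \<in> piece x i"
      "g i (x (Suc i)) - g i (x i) = deriv_on (piece x i) (g i) z * (x (Suc i) - x i)" by blast
    have "0 < deriv_on (piece x i) (g i) z * (x (Suc i) - x i)"
      using up z(4) by linarith
    then have "0 < deriv_on (piece x i) (g i) z"
      using knots_less[OF i] by (simp only: zero_less_mult_pos2 diff_gt_0_iff_gt)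
    moreover have "x 0 < z" "z < x (Suc k)"
      using z(1,2) i knots_le[of 0 i] knots_le[of "Suc i" "Suc k"] by auto
    ultimately show False using found[OF i z(3)] no by blast
  qed
  have "g i (x (Suc i)) \<le> g 0 (x 0)" if "i \<le> k" for i
    using that
  proof (induction i)
    case (Suc i)
    then show ?case using step[of "Suc i"] kn[of i] by simp
  qed (use step[of 0] in simp)
  then show False using rise by force
qed

end

locale ecp_spline = knots k x for k :: nat and x :: "nat \<Rightarrow> real" +
  fixes n :: nat and U :: "nat \<Rightarrow> (real \<Rightarrow> real) set" and R :: "nat \<Rightarrow> nat \<Rightarrow> nat \<Rightarrow> real"
  assumes n: "n \<ge> 1"
    and U: "\<And>i. i \<le> k \<Longrightarrow> subspace (U i)"
    and R: "\<And>i. i < k \<Longrightarrow> connection_matrix (Suc n) (R (Suc i))"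
    and constants: "\<And>c. pw_const k x c \<in> spline_space (Suc n) k x U R"
    and ECP: "ECP_space k x n (pw_deriv k x ` spline_space (Suc n) k x U R)"
begin

abbreviation S :: "pw set" where "S \<equiv> spline_space (Suc n) k x U R"
abbreviation DS :: "pw set" where "DS \<equiv> pw_deriv k x ` S"

lemma S_smooth: "s \<in> S \<Longrightarrow> i \<le> k \<Longrightarrow> smooth n (piece x i) (s i)"
  by (auto simp: spline_space_def pw_C_def C_on_iff)

lemma S_knot:
  assumes "s \<in> S" "i < k" "p \<le> n"
  shows "derivs_on (piece x (Suc i)) p (s (Suc i)) (x (Suc i)) =
    (\<Sum>q<Suc n. R (Suc i) p q * derivs_on (piece x i) q (s i) (x (Suc i)))"
proof -
  have "\<forall>i\<in>{1..k}. \<forall>p<Suc n. derivs_on (piece x i) p (s i) (x i) =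
      (\<Sum>q<Suc n. R i p q * derivs_on (piece x (i - 1)) q (s (i - 1)) (x i))"
    using assms(1) by (simp add: spline_space_def)
  from bspec[OF this, of "Suc i"] show ?thesis using assms(2,3) by (simp only: diff_Suc_1) auto
qed

lemma S_continuous:
  assumes "s \<in> S" "i < k"
  shows "s (Suc i) (x (Suc i)) = s i (x (Suc i))"
proof -
  have "R (Suc i) 0 q = (if q = 0 then 1 else 0)" if "q < Suc n" for q
    using R[OF assms(2)] that by (simp add: connection_matrix_def)
  then have "(\<Sum>q<Suc n. R (Suc i) 0 q * derivs_on (piece x i) q (s i) (x (Suc i))) =
      (\<Sum>q<Suc n. if q = 0 then s i (x (Suc i)) else 0)"
    by (intro sum.cong) auto
  also have "\<dots> = s i (x (Suc i))" by simp
  finally show ?thesis using S_knot[OF assms, of 0] by simp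
qed

text \<open>The first column of the connection matrix is that of the identity, so the function value
  does not influence the derivatives across the knot. Triangularity then isolates the diagonal
  entry.\<close>

lemma DS_connected:
  assumes i: "i < k" and r: "r < n"
  shows "\<exists>\<rho>>0. \<forall>G\<in>DS. vanishes (piece x i) r (G i) (x (Suc i)) \<longrightarrow>
    derivs_on (piece x (Suc i)) r (G (Suc i)) (x (Suc i)) =
      \<rho> * derivs_on (piece x i) r (G i) (x (Suc i))"
proof (intro exI conjI ballI impI)
  let ?R = "R (Suc i)" and ?y = "x (Suc i)"
  have M: "\<And>q. Suc r < q \<Longrightarrow> q < Suc n \<Longrightarrow> ?R (Suc r) q = 0" "?R (Suc r) (Suc r) > 0"
    "?R (Suc r) 0 = 0"
    using R[OF i] r by (auto simp: connection_matrix_def)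
  show "?R (Suc r) (Suc r) > 0" by (rule M(2))
  fix G assume "G \<in> DS" and v: "vanishes (piece x i) r (G i) ?y"
  then obtain s where s: "s \<in> S" "G = pw_deriv k x s" by blast
  have G: "G i = deriv_on (piece x i) (s i)" "G (Suc i) = deriv_on (piece x (Suc i)) (s (Suc i))"
    using i by (simp_all add: s(2) pw_deriv_def)
  have z: "?R (Suc r) q * derivs_on (piece x i) q (s i) ?y = 0" if "q < Suc n" "q \<noteq> Suc r" for q
  proof (cases q)
    case (Suc q')
    show ?thesis
    proof (cases "q < Suc r")
      case True
      then have "derivs_on (piece x i) q' (G i) ?y = 0"
        using v Suc by (simp add: vanishes_def)
      then show ?thesis unfolding Suc derivs_on_Suc G by simp
    qed (use M(1)[of q] that in simp)
  qed (use M(3) in simp)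
  have "derivs_on (piece x (Suc i)) r (G (Suc i)) ?y = derivs_on (piece x (Suc i)) (Suc r) (s (Suc i)) ?y"
    unfolding G derivs_on_Suc ..
  also have "\<dots> = (\<Sum>q<Suc n. ?R (Suc r) q * derivs_on (piece x i) q (s i) ?y)"
    using S_knot[OF s(1) i, of "Suc r"] r by simp
  also have "\<dots> = (\<Sum>q<Suc n. if q = Suc r
      then ?R (Suc r) (Suc r) * derivs_on (piece x i) (Suc r) (s i) ?y else 0)"
    using z by (intro sum.cong) auto
  also have "\<dots> = ?R (Suc r) (Suc r) * derivs_on (piece x i) (Suc r) (s i) ?y"
    using r by simp
  also have "\<dots> = ?R (Suc r) (Suc r) * derivs_on (piece x i) r (G i) ?y"
    unfolding G derivs_on_Suc ..
  finally show "derivs_on (piece x (Suc i)) r (G (Suc i)) ?y =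
      ?R (Suc r) (Suc r) * derivs_on (piece x i) r (G i) ?y" .
qed

lemma DS_facts: "subspace DS" "DS \<subseteq> pw_C (n - 1) k x"
  "\<And>F. F \<in> DS \<Longrightarrow> F \<noteq> 0 \<Longrightarrow> total_mult {x 0..x (Suc k)} (pw_zero_mult k x n F) \<le> enat (n - 1)"
  using ECP unfolding ECP_space_def by blast+

lemma DS_vanishes_right:
  assumes "G \<in> DS" "i < k" "r \<le> n" "vanishes (piece x i) r (G i) (x (Suc i))"
  shows "vanishes (piece x (Suc i)) r (G (Suc i)) (x (Suc i))"
  unfolding vanishes_def
proof (intro allI impI)
  fix q assume q: "q < r"
  then have "q < n" using assms(3) by simp
  from DS_connected[OF assms(2) this]
  obtain \<rho> where \<rho>: "\<forall>G\<in>DS. vanishes (piece x i) q (G i) (x (Suc i)) \<longrightarrow>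
      derivs_on (piece x (Suc i)) q (G (Suc i)) (x (Suc i)) =
      \<rho> * derivs_on (piece x i) q (G i) (x (Suc i))"
    by blast
  have "vanishes (piece x i) q (G i) (x (Suc i))"
    "derivs_on (piece x i) q (G i) (x (Suc i)) = 0"
    using assms(4) q by (simp_all add: vanishes_def)
  then show "derivs_on (piece x (Suc i)) q (G (Suc i)) (x (Suc i)) = 0"
    using bspec[OF \<rho> assms(1)] by simp
qed

lemma DS_mult_ge:
  assumes G: "G \<in> DS" and it: "i \<le> k" "t \<in> piece x i" and r: "r \<le> n"
    and v: "vanishes (piece x i) r (G i) t"
  shows "r \<le> pw_zero_mult k x n G t"
proof (cases "i < k \<and> t = x (Suc i)")
  case True
  then have "piece_index k x t = Suc i"
    using knots_less[of "Suc i"] by (intro piece_index_eq) auto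
  moreover have "vanishes (piece x (Suc i)) r (G (Suc i)) t"
    using DS_vanishes_right[OF G _ r] True v by simp
  ultimately show ?thesis
    using zero_mult_ge r by (simp add: pw_zero_mult_def)
next
  case False
  then have "piece_index k x t = i"
    using it by (intro piece_index_eq) (auto simp: piece_def)
  then show ?thesis
    using zero_mult_ge[OF v r] by (simp add: pw_zero_mult_def)
qed

text \<open>All that is needed of the bound on zeros: one zero at the left end and one elsewhere,
  counted with multiplicities.\<close>

lemma DS_two_points:
  assumes G: "G \<in> DS" and it: "i \<le> k" "t \<in> piece x i" "x 0 < t"
    and v: "vanishes (piece x 0) p (G 0) (x 0)" "vanishes (piece x i) q (G i) t"
    and pq: "p \<le> n" "q \<le> n" "n \<le> p + q"
  shows "G = 0"
proof (rule ccontr)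
  assume "G \<noteq> 0"
  then have "pw_zero_mult k x n G (x 0) + pw_zero_mult k x n G t \<le> n - 1"
    using DS_facts(3)[OF G] piece_bounds[OF it(1,2)] it(3)
    by (intro total_mult_ge_two[of "{x 0..x (Suc k)}"]) auto
  moreover have "p \<le> pw_zero_mult k x n G (x 0)" "q \<le> pw_zero_mult k x n G t"
    using DS_mult_ge[OF G _ first_in_piece pq(1) v(1)] DS_mult_ge[OF G it(1,2) pq(2) v(2)] by auto
  ultimately show False using pq n by linarith
qed

context
  fixes f :: "nat \<Rightarrow> pw"
  assumes f: "transition_functions (Suc n) k x S f"
begin

text \<open>The index is shifted by two because the first transition function is constant and
  indices start at \<open>0\<close> here.\<close>

definition base :: "nat \<Rightarrow> pw"
  where "base l = pw_deriv k x (f (l + 2))"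

lemma f_in_S: "l < n \<Longrightarrow> f (l + 2) \<in> S"
  and f_at_a: "l < n \<Longrightarrow> r \<le> l \<Longrightarrow> derivs_on (piece x 0) r (f (l + 2) 0) (x 0) = 0"
  and f_at_b: "l < n \<Longrightarrow> r \<le> n - 1 - l \<Longrightarrow>
    derivs_on (piece x k) r (f (l + 2) k) (x (Suc k)) = (if r = 0 then 1 else 0)"
  using f unfolding transition_functions_def by auto

lemma base_in_DS: "l < n \<Longrightarrow> base l \<in> DS"
  using f_in_S by (simp add: base_def)

lemma base_at_a:
  assumes "l < n"
  shows "vanishes (piece x 0) l (base l 0) (x 0)"
proof -
  have "vanishes (piece x 0) (Suc l) (f (l + 2) 0) (x 0)"
    using f_at_a[OF assms] by (simp add: vanishes_def)
  then show ?thesis unfolding vanishes_Suc_deriv by (simp add: base_def pw_deriv_def)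
qed

lemma base_at_b:
  assumes "l < n"
  shows "vanishes (piece x k) (n - 1 - l) (base l k) (x (Suc k))"
  unfolding vanishes_def
proof (intro allI impI)
  fix r assume "r < n - 1 - l"
  then have "derivs_on (piece x k) (Suc r) (f (l + 2) k) (x (Suc k)) = 0"
    using f_at_b[OF assms, of "Suc r"] by simp
  then show "derivs_on (piece x k) r (base l k) (x (Suc k)) = 0"
    unfolding derivs_on_Suc by (simp add: base_def pw_deriv_def)
qed

lemma base_rises:
  assumes "l < n"
  shows "\<exists>i\<le>k. \<exists>z\<in>piece x i. x 0 < z \<and> z < x (Suc k) \<and> base l i z > 0"
proof -
  obtain p where p: "n = Suc p" using n by (cases n) auto
  have sm: "smooth (Suc p) (piece x i) (f (l + 2) i)" if "i \<le> k" for i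
    using S_smooth[OF f_in_S[OF assms] that] p by simp
  have kn: "f (l + 2) (Suc i) (x (Suc i)) = f (l + 2) i (x (Suc i))" if "i < k" for i
    using S_continuous[OF f_in_S[OF assms] that] .
  have "f (l + 2) 0 (x 0) < f (l + 2) k (x (Suc k))"
    using f_at_a[OF assms, of 0] f_at_b[OF assms, of 0] by simp
  from rising_derivative[where g = "f (l + 2)", OF sm kn this]
  obtain i z where "i \<le> k" "z \<in> piece x i" "x 0 < z" "z < x (Suc k)"
    "deriv_on (piece x i) (f (l + 2) i) z > 0" by blast
  then show ?thesis by (intro exI[of _ i] conjI bexI[of _ z]) (simp_all add: base_def pw_deriv_def)
qed

text \<open>One more zero at the left end would bring the total to \<open>n\<close>, whereas the
  derivative of a transition function is not zero.\<close>

lemma base_exact_at_a: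
  assumes "l < n"
  shows "\<not> vanishes (piece x 0) (Suc l) (base l 0) (x 0)"
proof
  assume v: "vanishes (piece x 0) (Suc l) (base l 0) (x 0)"
  have "x 0 < x (Suc k)" using knots_less[of 0] knots_le[of 1 "Suc k"] by simp
  then have "base l = 0"
    by (rule DS_two_points[OF base_in_DS[OF assms] order_refl last_in_piece _ v base_at_b[OF assms]])
      (use assms in auto)
  then show False using base_rises[OF assms] by simp
qed

lemma base_smooth: "closed.smooth_family n base"
  using base_in_DS DS_facts(2)
  by (force simp: closed.smooth_family_def pw_C_def C_on_iff)

lemma comb_base_in_DS: "comb n c base \<in> DS"
  using DS_facts(1) base_in_DS by (rule comb_in_subspace)

lemma derivs_comb_base:
  assumes "i \<le> k" "r < n"
  shows "derivs_on (piece x i) r (comb n c base i) t = (\<Sum>l<n. c l * derivs_on (piece x i) r (base l i) t)"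
proof -
  obtain p where p: "n = Suc p" using n by (cases n) auto
  show ?thesis using closed.derivs_comb[of p base i r c t] base_smooth assms p by simp
qed

lemma base_independent:
  assumes "comb n c base = 0" "h < n"
  shows "c h = 0"
  using assms(2)
proof (induction h rule: less_induct)
  case (less h)
  let ?D = "\<lambda>q. derivs_on (piece x 0) h (base q 0) (x 0)"
  have "c q * ?D q = 0" if "q < n" "q \<noteq> h" for q
    using less.IH[of q] that base_at_a[of q] by (cases "q < h") (auto simp: vanishes_def)
  then have "(\<Sum>q<n. c q * ?D q) = (\<Sum>q<n. if q = h then c h * ?D h else 0)"
    by (intro sum.cong) auto
  also have "\<dots> = c h * ?D h" using less.prems by simp
  finally have "c h * ?D h = derivs_on (piece x 0) h (comb n c base 0) (x 0)"
    using derivs_comb_base[of 0 h c "x 0"] less.prems by simp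
  also have "\<dots> = 0"
    using derivs_on_zero[OF closed.perfect_J[of 0], of h] by (simp add: assms(1) zero_fun_def)
  finally show ?case
    using base_exact_at_a[OF less.prems] base_at_a[OF less.prems] unfolding vanishes_Suc by simp
qed

lemma base_tail_independent:
  assumes it: "i \<le> k" "t \<in> piece x i" "x 0 < t"
  shows "closed.tail_independent n base i t"
  unfolding closed.tail_independent_def
proof (intro allI impI)
  fix l c h assume l: "l < n" and c: "\<forall>h<l. c h = 0" and h: "h < n"
    and v: "vanishes (piece x i) (n - l) (comb n c base i) t"
  have "vanishes (piece x 0) l (comb n c base 0) (x 0)"
    unfolding vanishes_def
  proof (intro allI impI)
    fix r assume r: "r < l"
    have "c q * derivs_on (piece x 0) r (base q 0) (x 0) = 0" if "q < n" for q
      using c r base_at_a[OF that] by (cases "q < l") (auto simp: vanishes_def)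
    then show "derivs_on (piece x 0) r (comb n c base 0) (x 0) = 0"
      using derivs_comb_base[of 0 r c] r l by (simp add: sum.neutral)
  qed
  then have "comb n c base = 0"
    by (rule DS_two_points[OF comb_base_in_DS it _ v]) (use l in auto)
  then show "c h = 0" using h by (rule base_independent)
qed

lemma base_bernstein: "bernstein_like n base"
proof -
  have "closed.connected_family n base"
    unfolding closed.connected_family_def
  proof (intro allI impI)
    fix i r assume "i < k" "r < n"
    from DS_connected[OF this] obtain \<rho> where "\<rho> > 0" "\<forall>G\<in>DS. vanishes (piece x i) r (G i) (x (Suc i)) \<longrightarrow>
      derivs_on (piece x (Suc i)) r (G (Suc i)) (x (Suc i)) =
      \<rho> * derivs_on (piece x i) r (G i) (x (Suc i))" by blast
    then show "\<exists>\<rho>>0. \<forall>c. vanishes (piece x i) r (comb n c base i) (x (Suc i)) \<longrightarrow>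
        derivs_on (piece x (Suc i)) r (comb n c base (Suc i)) (x (Suc i)) =
        \<rho> * derivs_on (piece x i) r (comb n c base i) (x (Suc i))"
      using comb_base_in_DS by blast
  qed
  then show ?thesis
    unfolding bernstein_like_def
    using base_smooth base_tail_independent base_at_b base_at_a base_exact_at_a by blast
qed

lemma base_positive: "positive_inside n base"
  using base_bernstein base_rises by (rule positive_insideI)

text \<open>Subtracting suitable multiples of the basis functions raises the order of vanishing at
  the left end to \<open>n\<close>, which forces the difference to be zero.\<close>

lemma base_spans: "DS = {comb n c base |c. True}"
proof (intro subset_antisym subsetI)
  fix G assume G: "G \<in> DS"
  have "\<exists>c. vanishes (piece x 0) p ((G - comb n c base) 0) (x 0)" if "p \<le> n" for p
    using that
  proof (induction p)
    case (Suc p)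
    then have p: "p < n" by simp
    from Suc.IH[OF less_imp_le[OF this]]
    obtain c where c: "vanishes (piece x 0) p ((G - comb n c base) 0) (x 0)" by blast
    let ?H = "G - comb n c base"
    let ?d = "derivs_on (piece x 0) p (base p 0) (x 0)"
    \<comment> \<open>The multiple of \<open>base p\<close> that cancels the derivative of order \<open>p\<close>.\<close>
    define a where "a = derivs_on (piece x 0) p (?H 0) (x 0) / ?d"
    have d: "?d \<noteq> 0"
      using base_exact_at_a[OF p] base_at_a[OF p] unfolding vanishes_Suc by simp
    have "?H \<in> DS" using DS_facts(1) G comb_base_in_DS by (intro subspace_diff)
    then have "?H \<in> pw_C (n - 1) k x" using DS_facts(2) by blast
    then have sH: "smooth (n - 1) (piece x 0) (?H 0)"
      unfolding pw_C_def C_on_iff by blast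
    have sB: "smooth (n - 1) (piece x 0) (base p 0)"
      using base_smooth p by (simp add: closed.smooth_family_def)
    have H': "(G - comb n (\<lambda>q. c q + (if q = p then a else 0)) base) 0 = (\<lambda>t. ?H 0 t + - a * base p 0 t)"
    proof
      fix t
      have "comb n (\<lambda>q. c q - (- a) * (if q = p then 1 else 0)) base 0 t = comb n c base 0 t + a * base p 0 t"
        unfolding comb_diff[symmetric] comb_unit[OF p] by simp
      moreover have "(\<lambda>q. c q - (- a) * (if q = p then 1 else 0)) = (\<lambda>q. c q + (if q = p then a else 0))"
        by auto
      ultimately show "(G - comb n (\<lambda>q. c q + (if q = p then a else 0)) base) 0 t =
          ?H 0 t + - a * base p 0 t"
        by simp
    qed
    have "vanishes (piece x 0) (Suc p) (\<lambda>t. ?H 0 t + - a * base p 0 t) (x 0)"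
      unfolding vanishes_def
    proof (intro allI impI)
      fix r assume r: "r < Suc p"
      then have "derivs_on (piece x 0) r (\<lambda>t. ?H 0 t + - a * base p 0 t) (x 0) =
          derivs_on (piece x 0) r (?H 0) (x 0) + - a * derivs_on (piece x 0) r (base p 0) (x 0)"
        using derivs_on_add[OF closed.perfect_J[of 0] sH smooth_cmult[OF closed.perfect_J[of 0] sB, of "- a"], of r]
          derivs_on_cmult[OF closed.perfect_J[of 0] sB, of r "- a"] p by simp
      also have "\<dots> = 0"
      proof (cases "r = p")
        case True
        then show ?thesis using d by (simp add: a_def)
      next
        case False
        then have "r < p" using r by simp
        then show ?thesis using c base_at_a[OF p] by (simp add: vanishes_def)
      qed
      finally show "derivs_on (piece x 0) r (\<lambda>t. ?H 0 t + - a * base p 0 t) (x 0) = 0" .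
    qed
    then show ?case unfolding H'[symmetric] by blast
  qed (simp)
  then obtain c where c: "vanishes (piece x 0) n ((G - comb n c base) 0) (x 0)" by blast
  have "G - comb n c base \<in> DS" using DS_facts(1) G comb_base_in_DS by (intro subspace_diff)
  moreover have "x 0 < x (Suc k)" using knots_less[of 0] knots_le[of 1 "Suc k"] by simp
  ultimately have "G - comb n c base = 0"
    using c by (intro DS_two_points[where t = "x (Suc k)" and i = k and p = n and q = 0])
      (simp_all only: last_in_piece vanishes_0 order_refl le0 add_0_right)
  then show "G \<in> {comb n c base |c. True}" by auto
qed (use comb_base_in_DS in blast)

end

end

section \<open>The recursion for the weights\<close>

lemma sum_from_2: "(\<Sum>l = 2..N + 1. g l) = (\<Sum>l<N. g (l + 2))" for g :: "nat \<Rightarrow> 'a :: comm_monoid_add"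
  by (induction N) auto

lemma sum_tail_from_2:
  fixes g :: "nat \<Rightarrow> real"
  shows "(\<Sum>h = l + 3..N + 1. g h) = (\<Sum>q<N. (if l < q then 1 else 0) * g (q + 2))"
  by (induction N) auto

lemma gen_deriv_shift:
  "gen_deriv k x (\<lambda>j. if j = 0 then pw_const k x 1 else w j) (Suc j) F =
    gen_deriv k x (\<lambda>j. w (Suc j)) j (pw_deriv k x F)"
proof (induction j)
  case 0
  have "pw_deriv k x (pw_divide F (pw_const k x 1)) = pw_deriv k x F"
    by (auto simp: pw_deriv_def pw_divide_def pw_const_def const_on_def fun_eq_iff
        intro!: fun_cong[OF deriv_on_cong])
  then show ?case by simp
next
  case (Suc j)
  then show ?case by simp
qed

context ecp_spline
begin

lemma S_add:
  assumes "s \<in> S" "u \<in> S"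
  shows "(\<lambda>i t. s i t + u i t) \<in> S"
proof -
  have in_C: "s \<in> pw_C n k x" "u \<in> pw_C n k x"
    and in_U: "\<And>i. i \<le> k \<Longrightarrow> s i \<in> U i" "\<And>i. i \<le> k \<Longrightarrow> u i \<in> U i"
    using assms by (simp_all add: spline_space_def)
  have 1: "(\<lambda>i t. s i t + u i t) \<in> pw_C n k x"
    using in_C by (auto simp: pw_C_def C_on_iff fun_eq_iff intro: smooth_add[OF closed.perfect_J])
  have 2: "(\<lambda>t. s i t + u i t) \<in> U i" if "i \<le> k" for i
    using subspace_add[OF U[OF that] in_U(1)[OF that] in_U(2)[OF that]] by (simp add: plus_fun_def)
  have 3: "derivs_on (piece x i) p (\<lambda>t. s i t + u i t) (x i) = (\<Sum>q<Suc n. R i p q *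
      derivs_on (piece x (i - 1)) q (\<lambda>t. s (i - 1) t + u (i - 1) t) (x i))"
    if ip: "i \<in> {1..k}" "p < Suc n" for i p
  proof -
    obtain j where j: "i = Suc j" "j < k" using ip(1) by (cases i) auto
    have d: "derivs_on (piece x i) q (\<lambda>t. s i t + u i t) t =
        derivs_on (piece x i) q (s i) t + derivs_on (piece x i) q (u i) t" if "i \<le> k" "q \<le> n" for i q t
      using derivs_on_add[OF closed.perfect_J[OF that(1)] S_smooth[OF assms(1) that(1)]
          S_smooth[OF assms(2) that(1)] that(2)] by simp
    have "(\<Sum>q<Suc n. R i p q * derivs_on (piece x j) q (\<lambda>t. s j t + u j t) (x i)) =
        (\<Sum>q<Suc n. R i p q * derivs_on (piece x j) q (s j) (x i)) +
        (\<Sum>q<Suc n. R i p q * derivs_on (piece x j) q (u j) (x i))"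
      unfolding sum.distrib[symmetric] using d[of j] j(2)
      by (intro sum.cong) (auto simp: distrib_left)
    then show ?thesis
      using d[of i p "x i"] S_knot[OF assms(1) j(2), of p] S_knot[OF assms(2) j(2), of p] ip j by simp
  qed
  show ?thesis
    using 1 2 3 by (simp add: spline_space_def)
qed

text \<open>Integration: with first weight \<open>1\<close>, the generalized derivatives of a
  function from the second on are those of its derivative, and two functions that are continuous at
  the knots and have the same derivative differ by a constant, which lies in
  \<open>S\<close>.\<close>

theorem weights_of_S:
  fixes w :: "nat \<Rightarrow> pw"
  assumes v: "weight_system k x n (\<lambda>j. w (Suc j))" and DS: "DS = ECP k x n (\<lambda>j. w (Suc j))"
  shows "associated_weights k x (Suc n) (\<lambda>j. if j = 0 then pw_const k x 1 else w j) S"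
  unfolding associated_weights_def
proof
  let ?v = "\<lambda>j. if j = 0 then pw_const k x 1 else w j"
  let ?w = "\<lambda>j. w (Suc j)"
  have SC: "S \<subseteq> pw_C n k x" by (auto simp: spline_space_def)
  show "weight_system k x (Suc n) ?v"
    unfolding weight_system_def
  proof (intro allI impI)
    fix j assume j: "j < Suc n"
    show "?v j \<in> pw_C (Suc n - j - 1) k x \<and> pw_positive k x (?v j)"
    proof (cases j)
      case 0
      then show ?thesis
        using constants[of 1] SC by (auto simp: pw_positive_def pw_const_def const_on_def)
    next
      case (Suc q)
      then show ?thesis using v j by (simp add: weight_system_def)
    qed
  qed
  obtain p where p: "n = Suc p" using n by (cases n) auto
  have shift: "gen_deriv k x ?v (Suc j) F = gen_deriv k x ?w j (pw_deriv k x F)" for F j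
    by (rule gen_deriv_shift)
  have v0: "gen_deriv k x ?v 0 F i t = F i t" if "i \<le> k" "t \<in> piece x i" for F i t
    using that by (simp add: pw_divide_def pw_const_def const_on_def)
  show "S = ECP k x (Suc n) ?v"
  proof (intro subset_antisym subsetI)
    fix s assume s: "s \<in> S"
    then have C: "s \<in> pw_C n k x" and D: "pw_deriv k x s \<in> ECP k x n ?w"
      using SC DS by auto
    show "s \<in> ECP k x (Suc n) ?v"
      unfolding ECP_def
    proof (intro CollectI conjI ballI allI impI)
      show "s \<in> pw_C (Suc n - 1) k x" using C by simp
      show "\<exists>c. \<forall>i\<le>k. \<forall>t\<in>piece x i. gen_deriv k x ?v (Suc n - 1) s i t = c"
        using D shift[of p s] unfolding ECP_def p by simp
      fix i j assume i: "i \<in> {1..k}" and j: "j < Suc n"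
      show "gen_deriv k x ?v j s i (x i) = gen_deriv k x ?v j s (i - 1) (x i)"
      proof (cases j)
        case 0
        obtain q where q: "i = Suc q" "q < k" using i by (cases i) auto
        then show ?thesis
          using v0[of i "x i" s] v0[of q "x i" s] S_continuous[OF s q(2)]
            closed.right_J[of q] closed.left_J[of q] unfolding 0 by simp
      next
        case (Suc q)
        have "\<forall>i\<in>{1..k}. \<forall>j<n. gen_deriv k x ?w j (pw_deriv k x s) i (x i) =
            gen_deriv k x ?w j (pw_deriv k x s) (i - 1) (x i)"
          using D by (simp add: ECP_def)
        then have "gen_deriv k x ?w q (pw_deriv k x s) i (x i) =
            gen_deriv k x ?w q (pw_deriv k x s) (i - 1) (x i)"
          using i j Suc by blast
        then show ?thesis unfolding Suc shift .
      qed
    qed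
  next
    fix F assume F: "F \<in> ECP k x (Suc n) ?v"
    then have C: "F \<in> pw_C n k x" by (simp add: ECP_def)
    have Fk: "gen_deriv k x ?v j F (Suc i) (x (Suc i)) = gen_deriv k x ?v j F i (x (Suc i))"
      if "i < k" "j < Suc n" for i j
    proof -
      have "\<forall>i\<in>{1..k}. \<forall>j<Suc n. gen_deriv k x ?v j F i (x i) = gen_deriv k x ?v j F (i - 1) (x i)"
        using F by (simp add: ECP_def)
      from bspec[OF this, of "Suc i"] show ?thesis using that by (simp only: diff_Suc_1) auto
    qed
    have "pw_deriv k x F \<in> ECP k x n ?w"
      unfolding ECP_def
    proof (intro CollectI conjI ballI allI impI)
      show "pw_deriv k x F \<in> pw_C (n - 1) k x"
        using C unfolding p by (auto simp: pw_C_def C_on_iff pw_deriv_def deriv_on_outside)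
      show "\<exists>c. \<forall>i\<le>k. \<forall>t\<in>piece x i. gen_deriv k x ?w (n - 1) (pw_deriv k x F) i t = c"
        using F shift[of p F] unfolding ECP_def p by simp
      fix i j assume "i \<in> {1..k}" and j: "j < n"
      then obtain q where q: "i = Suc q" "q < k" by (cases i) auto
      show "gen_deriv k x ?w j (pw_deriv k x F) i (x i) =
          gen_deriv k x ?w j (pw_deriv k x F) (i - 1) (x i)"
        using Fk[OF q(2), of "Suc j"] j unfolding shift q(1) by simp
    qed
    then obtain s where s: "s \<in> S" "pw_deriv k x F = pw_deriv k x s" using DS by auto
    define u where "u = (\<lambda>i t. s i t + pw_const k x (F 0 (x 0) - s 0 (x 0)) i t)"
    have u: "u \<in> S" unfolding u_def by (rule S_add[OF s(1) constants])
    have dFs: "deriv_on (piece x i) (F i) = deriv_on (piece x i) (s i)" if "i \<le> k" for i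
      using fun_cong[OF s(2), of i] that by (simp add: pw_deriv_def)
    have du: "deriv_on (piece x i) (u i) = deriv_on (piece x i) (s i)" if "i \<le> k" for i
    proof -
      have "deriv_on (piece x i) (u i) = deriv_on (piece x i) (\<lambda>t. s i t + (F 0 (x 0) - s 0 (x 0)))"
        using that by (intro deriv_on_cong) (simp add: u_def pw_const_def const_on_def)
      also have "\<dots> = deriv_on (piece x i) (s i)"
        using S_smooth[OF s(1) that] unfolding p
        by (subst deriv_on_add[OF closed.perfect_J[OF that]])
          (auto simp: deriv_on_const[OF closed.perfect_J[OF that]])
      finally show ?thesis .
    qed
    have eq: "F i t = u i t" if "i \<le> k" "t \<in> piece x i" for i t
    proof (rule pieces_equal_derivative[where g = F and h = u and p = p])
      show "smooth (Suc p) (piece x i) (F i)" if "i \<le> k" for i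
        using C that unfolding p by (simp add: pw_C_def C_on_iff)
      show "smooth (Suc p) (piece x i) (u i)" if "i \<le> k" for i
        using S_smooth[OF u that] unfolding p .
      show "deriv_on (piece x i) (F i) t = deriv_on (piece x i) (u i) t" if "i \<le> k" for i t
        unfolding dFs[OF that] du[OF that] ..
      show "F (Suc i) (x (Suc i)) = F i (x (Suc i))" if "i < k" for i
        using Fk[OF that, of 0] v0[of "Suc i" "x (Suc i)" F] v0[of i "x (Suc i)" F] that
          closed.right_J[of i] closed.left_J[of i] by simp
      show "u (Suc i) (x (Suc i)) = u i (x (Suc i))" if "i < k" for i
        by (rule S_continuous[OF u that])
      show "F 0 (x 0) = u 0 (x 0)"
        using first_in_piece by (simp add: u_def pw_const_def const_on_def)
    qed (use that in auto)
    have out: "H i t = 0" if "H \<in> pw_C n k x" "\<not> (i \<le> k \<and> t \<in> piece x i)" for H i t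
      using that by (cases "i \<le> k") (auto simp: pw_C_def C_on_def)
    have uC: "u \<in> pw_C n k x" using u SC by blast
    have "F i t = u i t" for i t
    proof (cases "i \<le> k \<and> t \<in> piece x i")
      case False
      show ?thesis unfolding out[OF C False] out[OF uC False] ..
    qed (use eq in blast)
    then have "F = u" by (intro ext)
    then show "F \<in> S" using u by simp
  qed
qed

context
  fixes f :: "nat \<Rightarrow> nat \<Rightarrow> pw" and w :: "nat \<Rightarrow> pw"
  assumes f: "transition_functions (Suc n) k x S (\<lambda>l. f l (Suc n))"
    and w_rec: "\<And>j. j < n \<Longrightarrow> w (Suc j) = (\<Sum>l = 2..n - j + 1. pw_deriv k x (f l (n - j + 1)))"
    and f_rec: "\<And>j l. j < n \<Longrightarrow> 1 \<le> l \<Longrightarrow> l \<le> n - j \<Longrightarrow>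
      f l (n - j) = pw_divide (\<Sum>h = l + 1..n - j + 1. pw_deriv k x (f h (n - j + 1))) (w (Suc j))"
begin

abbreviation Bs :: "nat \<Rightarrow> nat \<Rightarrow> pw" where "Bs \<equiv> level n (base (\<lambda>l. f l (Suc n)))"

lemma recursion_weight:
  assumes j: "j < n" and l: "\<And>l. l < n - j \<Longrightarrow> pw_deriv k x (f (l + 2) (n - j + 1)) = Bs j l"
  shows "w (Suc j) = comb (n - j) (\<lambda>q. 1) (Bs j)"
  unfolding w_rec[OF j] sum_from_2
proof (intro ext)
  fix i t
  show "(\<Sum>l<n - j. pw_deriv k x (f (l + 2) (n - j + 1))) i t = comb (n - j) (\<lambda>q. 1) (Bs j) i t"
    unfolding sum_pw_apply comb_def by (intro sum.cong) (simp_all only: l lessThan_iff mult_1)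
qed

text \<open>The recursion of the theorem is the passage from one basis to the next: the sum from
  \<open>l + 3\<close> on in the numerator is the tail after \<open>l\<close>, since the index of
  the transition functions is shifted by two.\<close>

lemma recursion_level:
  "j < n \<Longrightarrow> l < n - j \<Longrightarrow> pw_deriv k x (f (l + 2) (n - j + 1)) = Bs j l"
proof (induction j arbitrary: l)
  case 0
  then show ?case by (simp add: base_def[OF f])
next
  case (Suc j)
  then have j: "j < n" and nj: "n - j = Suc (n - Suc j)" and l: "l < n - Suc j" by auto
  note IH = Suc.IH[OF j]
  have w: "w (Suc j) = comb (n - j) (\<lambda>q. 1) (Bs j)"
    by (rule recursion_weight[OF j IH])
  have num: "(\<Sum>h = l + 2 + 1..n - j + 1. pw_deriv k x (f h (n - j + 1))) =
      comb (n - j) (\<lambda>q. if l < q then 1 else 0) (Bs j)"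
  proof (intro ext)
    fix i t
    have e: "l + 2 + 1 = l + 3" by simp
    have "(\<Sum>h = l + 3..n - j + 1. pw_deriv k x (f h (n - j + 1)) i t) =
        (\<Sum>q<n - j. (if l < q then 1 else 0) * pw_deriv k x (f (q + 2) (n - j + 1)) i t)"
      by (rule sum_tail_from_2)
    also have "\<dots> = (\<Sum>q<n - j. (if l < q then 1 else 0) * Bs j q i t)"
      using IH by (intro sum.cong) auto
    finally show "(\<Sum>h = l + 2 + 1..n - j + 1. pw_deriv k x (f h (n - j + 1))) i t =
        comb (n - j) (\<lambda>q. if l < q then 1 else 0) (Bs j) i t"
      unfolding sum_pw_apply comb_def e .
  qed
  have "f (l + 2) (n - j) = pw_divide (comb (n - j) (\<lambda>q. if l < q then 1 else 0) (Bs j))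
      (comb (n - j) (\<lambda>q. 1) (Bs j))"
    using f_rec[OF j, of "l + 2"] l unfolding num w by simp
  moreover have "n - Suc j + 1 = n - j" using nj by simp
  ultimately show ?case
    unfolding nj by (auto simp: pw_deriv_def pw_divide_def closed.quotient_family_def fun_eq_iff)
qed

theorem recursion_associated:
  "associated_weights k x (Suc n) (\<lambda>j. if j = 0 then pw_const k x 1 else w j) S"
  "associated_weights k x n (\<lambda>j. w (Suc j)) DS"
proof -
  let ?B = "base (\<lambda>l. f l (Suc n))"
  have v: "w (Suc j) = comb (n - j) (\<lambda>q. 1) (Bs j)" if "j < n" for j
    by (rule recursion_weight[OF that recursion_level[OF that]])
  have C: "?B l \<in> pw_C (n - 1) k x" if "l < n" for l
    using base_in_DS[OF f that] DS_facts(2) by blast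
  note hyps = n base_bernstein[OF f] base_positive[OF f] C v
  have ws: "weight_system k x n (\<lambda>j. w (Suc j))"
    by (rule level_weight_system[OF hyps])
  have DS: "DS = ECP k x n (\<lambda>j. w (Suc j))"
    using base_spans[OF f] range_comb_eq_ECP[OF hyps] by simp
  show "associated_weights k x n (\<lambda>j. w (Suc j)) DS"
    unfolding associated_weights_def using ws DS by blast
  show "associated_weights k x (Suc n) (\<lambda>j. if j = 0 then pw_const k x 1 else w j) S"
    by (rule weights_of_S[OF ws DS])
qed

end

end

theorem proposition7:
  fixes m k :: nat
    and a b :: real
    and x :: "nat \<Rightarrow> real"
    and U :: "nat \<Rightarrow> (real \<Rightarrow> real) set"
    and R :: "nat \<Rightarrow> nat \<Rightarrow> nat \<Rightarrow> real"
    and S :: "pw set"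
    and f :: "nat \<Rightarrow> nat \<Rightarrow> pw"
    and w :: "nat \<Rightarrow> pw"
  assumes "m \<ge> 2"
    and "x 0 = a" and "x (Suc k) = b" and "\<forall>i\<le>k. x i < x (Suc i)"
    and "\<forall>i\<le>k. EC_space (piece x i) m (U i)"
    and "\<forall>i\<le>k. \<forall>c. const_on (piece x i) c \<in> U i"
    and "\<forall>i\<le>k. EC_space (piece x i) (m - 1) (deriv_on (piece x i) ` U i)"
    and "\<forall>i\<in>{1..k}. connection_matrix m (R i)"
    and "S = spline_space m k x U R"
    and "\<forall>c. pw_const k x c \<in> S"
    and "ECP_space k x (m - 1) (pw_deriv k x ` S)"
    and "transition_functions m k x S (\<lambda>l. f l m)"
    and "\<forall>j\<in>{1..m - 1}. w j = (\<Sum>l = 2..m - j + 1. pw_deriv k x (f l (m - j + 1)))"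
    and "\<forall>j\<in>{1..m - 1}. \<forall>l\<in>{1..m - j}.
      f l (m - j) = pw_divide (\<Sum>h = l + 1..m - j + 1. pw_deriv k x (f h (m - j + 1))) (w j)"
  shows "associated_weights k x m (\<lambda>j. if j = 0 then pw_const k x 1 else w j) S \<and>
    associated_weights k x (m - 1) (\<lambda>j. w (Suc j)) (pw_deriv k x ` S)"
proof -
  obtain n where m: "m = Suc n" and n: "n \<ge> 1" using assms(1) by (cases m) auto
  interpret ecp_spline k x n U R
  proof
    show "x i < x (Suc i)" if "i \<le> k" for i using assms(4) that by blast
    show "subspace (U i)" if "i \<le> k" for i using assms(5) that by (auto simp: EC_space_def)
    show "connection_matrix (Suc n) (R (Suc i))" if "i < k" for i using assms(8) that by (auto simp: m)
    show "pw_const k x c \<in> spline_space (Suc n) k x U R" for c using assms(9,10) by (simp add: m)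
    show "ECP_space k x n (pw_deriv k x ` spline_space (Suc n) k x U R)"
      using assms(9,11) by (simp add: m)
  qed (rule n)
  have S: "S = spline_space (Suc n) k x U R" using assms(9) by (simp add: m)
  have t: "transition_functions (Suc n) k x (spline_space (Suc n) k x U R) (\<lambda>l. f l (Suc n))"
    using assms(12) unfolding S m .
  have w: "w (Suc j) = (\<Sum>l = 2..n - j + 1. pw_deriv k x (f l (n - j + 1)))" if "j < n" for j
    using bspec[OF assms(13), of "Suc j"] that by (simp add: m)
  have f: "f l (n - j) = pw_divide (\<Sum>h = l + 1..n - j + 1. pw_deriv k x (f h (n - j + 1))) (w (Suc j))"
    if "j < n" "1 \<le> l" "l \<le> n - j" for j l
    using bspec[OF bspec[OF assms(14), of "Suc j"], of l] that by (simp add: m)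
  show ?thesis
    using recursion_associated[OF t w f] by (simp add: m S)
qed

end
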